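(* Assume $K_2=1$ in (A2), $r_k\ge4/7$ for all $k\ge2$, $\kappa\ge\|f'\|_{C[-\beta,\beta]}$, $\|\phi^0\|_\infty\le\beta$, and $$\tau_1\le\min\Big\{\Big(\frac{4}{11\varsigma m(\kappa+4\varepsilon^2/h^2)\Gamma(2-\alpha)}\Big)^{1/\alpha},\Big(\frac{4}{11\kappa(1-\varsigma)m\Gamma(2-\alpha)}\Big)^{1/\alpha}\Big\}.$$ Then the unbalanced $L2$-$1_\sigma$-sESAV scheme is energy-stable without further time-step size restriction: $\mathcal E_h[\phi^n,R^n]\le\mathcal E_h[\phi^0,R^0]$ for all $n\ge1$.
   Context: Setting: $\Omega=(0,L)^2$ with periodic boundary conditions; constants $m>0$, $\varepsilon>0$, $\alpha\in(0,1)$, and $\varsigma:=\alpha/2$. The nonlinearity $f=-F'$ is one of: (double-well) $F(\phi)=\frac14(1-\phi^2)^2$, $f(\phi)=\phi-\phi^3$, with $\beta=1$; or (Flory–Huggins) $F(\phi)=\frac{\theta}{2}[(1+\phi)\ln(1+\phi)+(1-\phi)\ln(1-\phi)]-\frac{\theta_c}{2}\phi^2$, $f(\phi)=\frac{\theta}{2}\ln\frac{1-\phi}{1+\phi}+\theta_c\phi$ on $(-1,1)$, with $\theta_c>\theta>0$ and $\beta\in(0,1)$ the positive root of $f$. In both cases $f(\pm\beta)=0$. Spatial discretization: $M\in\mathbb N$, $h=L/M$; $\mathbb V_h$ is the space of real grid functions $v=\{v_{ij}\}_{i,j\in\mathbb Z}$ that are $M$-periodic in each index; $\langle v,w\rangle=h^2\sum_{i,j=1}^Mv_{ij}w_{ij}$,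 $\|v\|=\sqrt{\langle v,v\rangle}$, $\|v\|_\infty=\max_{1\le i,j\le M}|v_{ij}|$; $\Delta_hv_{ij}=h^{-2}(v_{i+1,j}+v_{i-1,j}+v_{i,j+1}+v_{i,j-1}-4v_{ij})$; $\nabla_hv_{ij}=\big(\frac{v_{i+1,j}-v_{ij}}h,\frac{v_{i,j+1}-v_{ij}}h\big)$ and $\|\nabla_hv\|^2=h^2\sum_{i,j=1}^M|\nabla_hv_{ij}|^2$. Scalar functions act on grid functions pointwise. $E_{1h}[v]=\langle F(v),1\rangle$ and $g_h(v,w)=\exp(w)/\exp(E_{1h}[v])$ for $v\in\mathbb V_h$ (with $\|v\|_\infty<1$ in the Flory–Huggins case) and $w\in\mathbb R$. The discrete modified energy is $\mathcal E_h[\phi,R]=\frac{\varepsilon^2}{2}\|\nabla_h\phi\|^2+R$. Auxiliary functional: $V:\mathbb R\to\mathbb R$ satisfies (A1) $V\in C^1(\mathbb R)\cap W^{2,\infty}(\mathbb R)$, $V(1)=1$, $V'(1)=0$, $|V'|\le K_1$; (A2) $0\le V\le K_2$ for a constant $K_2>0$; (A3) $|z_1-1|\le|z_2-1|$ implies $|V(z_1)-1|\le|V(z_2)-1|$. Time grid: $0=t_0<t_1<\dots<t_N=T$, $\tau_k=t_k-t_{k-1}$, $r_k=\tau_k/\tau_{k-1}$ ($k\ge2$), $\nabla_\tau v^k=v^k-v^{k-1}$, $\mathbb D_\tau v^k=\nabla_\tau v^k/\tau_k$, $\omega_\mu(t)=t^{\mu-1}/\Gamma(\mu)$. Constant $\kappa\ge0$;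 data $\phi^0\in\mathbb V_h$, $R^0\in\mathbb R$. For $n\ge2$ the predicted solution is $\hat\phi^n=\min\{\max\{(1+r_n)\phi^{n-1}-r_n\phi^{n-2},-\beta\},\beta\}$ (pointwise). $L2$-$1_\sigma$ discretization: $t_{k-\varsigma}=(1-\varsigma)t_k+\varsigma t_{k-1}$, $t_{k-1/2}=(t_k+t_{k-1})/2$; $a^{(n)}_{n-k}=\frac1{\tau_k}\int_{t_{k-1}}^{\min\{t_k,t_{n-\varsigma}\}}\omega_{1-\alpha}(t_{n-\varsigma}-s)\,ds$ ($1\le k\le n$), $b^{(n)}_{n-k}=\frac{2}{\tau_k(\tau_k+\tau_{k+1})}\int_{t_{k-1}}^{t_k}(s-t_{k-1/2})\omega_{1-\alpha}(t_{n-\varsigma}-s)\,ds$ ($1\le k\le n-1$); $B^{(1)}_0=a^{(1)}_0$, and for $n\ge2$: $B^{(n)}_0=a^{(n)}_0+b^{(n)}_1/r_n$, $B^{(n)}_{n-k}=a^{(n)}_{n-k}+b^{(n)}_{n-k+1}/r_k-b^{(n)}_{n-k}$ for $2\le k\le n-1$, $B^{(n)}_{n-1}=a^{(n)}_{n-1}-b^{(n)}_{n-1}$; $\tilde{\mathbb D}^\alpha_\tau v^n=\sum_{k=1}^nB^{(n)}_{n-k}\nabla_\tau v^k$; $w^{k-\varsigma}=(1-\varsigma)w^k+\varsigma w^{k-1}$. Unbalanced $L2$-$1_\sigma$-sESAV scheme: $\hat\phi^1\in\mathbb V_h$ with $\|\hat\phi^1\|_\infty\le\beta$ solves $B^{(1)}_0(\hat\phi^1-\phi^0)=m(\varepsilon^2\Delta_h\hat\phi^{1-\varsigma}+f(\hat\phi^{1-\varsigma}))$;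 for $n\ge2$, $\hat\phi^n$ is the predicted solution above. For $n\ge1$ set $\hat\phi^{n-\varsigma}=(1-\varsigma)\hat\phi^n+\varsigma\phi^{n-1}$ and $V^{n-\varsigma}=V(g_h(\hat\phi^{n-\varsigma},R^{n-1}))$, and define $(\phi^n,R^n)$ by $\tilde{\mathbb D}^\alpha_\tau\phi^n=m(\varepsilon^2\Delta_h\phi^{n-\varsigma}+V^{n-\varsigma}f(\hat\phi^{n-\varsigma})-\kappa(\phi^{n-\varsigma}-V^{n-\varsigma}\hat\phi^{n-\varsigma}))$ and $\mathbb D_\tau R^n=-V^{n-\varsigma}\langle f(\hat\phi^{n-\varsigma}),\mathbb D_\tau\phi^n\rangle+\kappa\langle\phi^{n-\varsigma}-V^{n-\varsigma}\hat\phi^{n-\varsigma},\mathbb D_\tau\phi^n\rangle$. *)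

theory Defs
  imports "HOL-Analysis.Analysis"
begin

type_synonym grid = "int \<times> int \<Rightarrow> real"

definition periodic_grid :: "nat \<Rightarrow> grid \<Rightarrow> bool" where
  "periodic_grid M v \<longleftrightarrow>
     (\<forall>i j. v (i + int M, j) = v (i, j) \<and> v (i, j + int M) = v (i, j))"

definition ginner :: "real \<Rightarrow> nat \<Rightarrow> grid \<Rightarrow> grid \<Rightarrow> real" where
  "ginner h M v w = h\<^sup>2 * (\<Sum>i\<in>{1..int M}. \<Sum>j\<in>{1..int M}. v (i, j) * w (i, j))"

definition gsupnorm :: "nat \<Rightarrow> grid \<Rightarrow> real" where
  "gsupnorm M v = Max {\<bar>v (i, j)\<bar> | i j. i \<in> {1..int M} \<and> j \<in> {1..int M}}"

definition glap :: "real \<Rightarrow> grid \<Rightarrow> grid" where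
  "glap h v = (\<lambda>(i, j). (v (i + 1, j) + v (i - 1, j) + v (i, j + 1) + v (i, j - 1)
                          - 4 * v (i, j)) / h\<^sup>2)"

definition ggradnorm2 :: "real \<Rightarrow> nat \<Rightarrow> grid \<Rightarrow> real" where
  "ggradnorm2 h M v = h\<^sup>2 * (\<Sum>i\<in>{1..int M}. \<Sum>j\<in>{1..int M}.
      ((v (i + 1, j) - v (i, j)) / h)\<^sup>2 + ((v (i, j + 1) - v (i, j)) / h)\<^sup>2)"

definition E1h :: "(real \<Rightarrow> real) \<Rightarrow> real \<Rightarrow> nat \<Rightarrow> grid \<Rightarrow> real" where
  "E1h F h M v = ginner h M (\<lambda>x. F (v x)) (\<lambda>_. 1)"

definition gh :: "(real \<Rightarrow> real) \<Rightarrow> real \<Rightarrow> nat \<Rightarrow> grid \<Rightarrow> real \<Rightarrow> real" where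
  "gh F h M v w = exp w / exp (E1h F h M v)"

definition energy_h :: "real \<Rightarrow> real \<Rightarrow> nat \<Rightarrow> grid \<Rightarrow> real \<Rightarrow> real" where
  "energy_h \<epsilon> h M \<phi> R = \<epsilon>\<^sup>2 / 2 * ggradnorm2 h M \<phi> + R"

definition F_dw :: "real \<Rightarrow> real" where "F_dw x = (1 - x\<^sup>2)\<^sup>2 / 4"
definition f_dw :: "real \<Rightarrow> real" where "f_dw x = x - x ^ 3"

definition F_fh :: "real \<Rightarrow> real \<Rightarrow> real \<Rightarrow> real" where
  "F_fh \<theta> \<theta>c x = \<theta> / 2 * ((1 + x) * ln (1 + x) + (1 - x) * ln (1 - x)) - \<theta>c / 2 * x\<^sup>2"
definition f_fh :: "real \<Rightarrow> real \<Rightarrow> real \<Rightarrow> real" where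
  "f_fh \<theta> \<theta>c x = \<theta> / 2 * ln ((1 - x) / (1 + x)) + \<theta>c * x"

definition tau :: "(nat \<Rightarrow> real) \<Rightarrow> nat \<Rightarrow> real" where
  "tau t k = t k - t (k - 1)"

definition ratio :: "(nat \<Rightarrow> real) \<Rightarrow> nat \<Rightarrow> real" where
  "ratio t k = tau t k / tau t (k - 1)"

definition omega :: "real \<Rightarrow> real \<Rightarrow> real" where
  "omega \<mu> s = s powr (\<mu> - 1) / Gamma \<mu>"

text \<open>t_{k-\<sigma>} with \<sigma> = \<alpha>/2.\<close>
definition tsig :: "(nat \<Rightarrow> real) \<Rightarrow> real \<Rightarrow> nat \<Rightarrow> real" where
  "tsig t \<alpha> k = (1 - \<alpha> / 2) * t k + \<alpha> / 2 * t (k - 1)"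

text \<open>acoef t \<alpha> n k = a^{(n)}_{n-k} (1 <= k <= n).\<close>
definition acoef :: "(nat \<Rightarrow> real) \<Rightarrow> real \<Rightarrow> nat \<Rightarrow> nat \<Rightarrow> real" where
  "acoef t \<alpha> n k = (1 / tau t k) *
     integral {t (k - 1) .. min (t k) (tsig t \<alpha> n)} (\<lambda>s. omega (1 - \<alpha>) (tsig t \<alpha> n - s))"

text \<open>bcoef t \<alpha> n k = b^{(n)}_{n-k} (1 <= k <= n-1).\<close>
definition bcoef :: "(nat \<Rightarrow> real) \<Rightarrow> real \<Rightarrow> nat \<Rightarrow> nat \<Rightarrow> real" where
  "bcoef t \<alpha> n k = 2 / (tau t k * (tau t k + tau t (k + 1))) *
     integral {t (k - 1) .. t k}
       (\<lambda>s. (s - (t k + t (k - 1)) / 2) * omega (1 - \<alpha>) (tsig t \<alpha> n - s))"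

text \<open>Bcoef t \<alpha> n k = B^{(n)}_{n-k} (1 <= k <= n).\<close>
definition Bcoef :: "(nat \<Rightarrow> real) \<Rightarrow> real \<Rightarrow> nat \<Rightarrow> nat \<Rightarrow> real" where
  "Bcoef t \<alpha> n k =
     (if n = 1 then acoef t \<alpha> 1 1
      else if k = n then acoef t \<alpha> n n + bcoef t \<alpha> n (n - 1) / ratio t n
      else if k = 1 then acoef t \<alpha> n 1 - bcoef t \<alpha> n 1
      else acoef t \<alpha> n k + bcoef t \<alpha> n (k - 1) / ratio t k - bcoef t \<alpha> n k)"

definition Dalpha :: "(nat \<Rightarrow> real) \<Rightarrow> real \<Rightarrow> (nat \<Rightarrow> grid) \<Rightarrow> nat \<Rightarrow> grid" where
  "Dalpha t \<alpha> v n = (\<lambda>x. \<Sum>k\<in>{1..n}. Bcoef t \<alpha> n k * (v k x - v (k - 1) x))"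

definition phat :: "(nat \<Rightarrow> real) \<Rightarrow> real \<Rightarrow> (nat \<Rightarrow> grid) \<Rightarrow> grid \<Rightarrow> nat \<Rightarrow> grid" where
  "phat t \<beta> \<phi> hat1 n =
     (if n = 1 then hat1
      else (\<lambda>x. min (max ((1 + ratio t n) * \<phi> (n - 1) x - ratio t n * \<phi> (n - 2) x) (- \<beta>)) \<beta>))"

end

theory Submission
  imports Defs
begin

text \<open>
  Eliminating the nonlinear terms between the equations for \<open>\<phi>\<close> and \<open>R\<close> shows that, up to a
  nonpositive gradient term, the energy changes in step \<open>n\<close> by \<open>-1/m\<close> times the inner product of the
  discrete fractional derivative with the increment of \<open>\<phi>\<close>. So stability follows once the
  convolution kernels \<open>B\<close> are positive semidefinite. Write \<open>c(n,j) = B(n,j) - B(n,j-1)\<close>, where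
  \<open>B(n,k)\<close> stands for the coefficient with lower index \<open>n - k\<close>. Summation by parts in both indices
  represents the quadratic form as a nonnegative combination of squares as soon as \<open>c(n,j)\<close> is
  nonnegative and decreasing in \<open>n\<close>, where on the diagonal only \<open>c(n,n) + B(n,n)\<close> has to dominate
  \<open>c(n+1,n)\<close>. Off the diagonal, \<open>c(n,j)\<close> and \<open>c(n,j) - c(n+1,j)\<close> are one linear functional applied to
  the memory kernel, respectively to the difference of two consecutive ones. Both functions are increasing
  and convex, and on such functions the functional is nonnegative whenever the step ratios are at
  least \<open>4/7\<close>.
\<close>

subsection \<open>A criterion for positive semidefiniteness\<close>

text \<open>Abel summation in \<open>k\<close> replaces the increments \<open>w k\<close> by the
  tail sums \<open>W j n\<close>, which turns the form into half a sum of squares weighted by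
  \<open>c\<close>. Passing from level \<open>n\<close> to \<open>n + 1\<close> is harmless once the
  weight of each existing square does not grow. The diagonal weight \<open>d n n\<close> is larger
  than \<open>c n n\<close> because a tail sum starting at \<open>n\<close> has no earlier square to
  subtract.\<close>

lemma quadratic_form_nonneg:
  fixes B :: "nat \<Rightarrow> nat \<Rightarrow> real" and w :: "nat \<Rightarrow> real"
  defines "c \<equiv> \<lambda>n j. B n j - (if j = 1 then 0 else B n (j - 1))"
  defines "d \<equiv> \<lambda>n j. c n j + (if j = n then B n n else 0)"
  assumes step: "\<And>n j. 1 \<le> j \<Longrightarrow> j \<le> n \<Longrightarrow> n < N \<Longrightarrow> c (Suc n) j \<le> d n j"
    and last: "\<And>j. 1 \<le> j \<Longrightarrow> j \<le> N \<Longrightarrow> 0 \<le> d N j"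
  shows "0 \<le> (\<Sum>n=1..N. w n * (\<Sum>k=1..n. B n k * w k))"
proof -
  \<comment> \<open>\<open>w n * W j n\<close> is half of \<open>(W j n)\<^sup>2 - (W j (n - 1))\<^sup>2 + (w n)\<^sup>2\<close>, which telescopes in \<open>n\<close>.\<close>
  define W where "W j n = (\<Sum>i=j..n. w i)" for j n
  have W_Suc: "W j (Suc n) = W j n + w (Suc n)" if "j \<le> Suc n" for j n
    using that by (simp add: W_def)
  have tel: "(\<Sum>j=1..n. c l j) = (if n = 0 then 0 else B l n)" for l n
    by (induction n) (auto simp: c_def)
  have abel: "(\<Sum>k=1..n. B l k * w k) = (\<Sum>j=1..n. c l j * W j n)" for l n
  proof (induction n)
    case (Suc n)
    have "(\<Sum>j=1..Suc n. c l j * W j (Suc n))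
        = (\<Sum>j=1..n. c l j * W j n + c l j * w (Suc n)) + c l (Suc n) * w (Suc n)"
      by (simp add: W_Suc algebra_simps) (simp add: W_def)
    also have "\<dots> = (\<Sum>j=1..n. c l j * W j n) + (\<Sum>j=1..Suc n. c l j) * w (Suc n)"
      by (simp add: sum.distrib sum_distrib_right distrib_right)
    finally show ?case using Suc tel[of l "Suc n"] by simp
  qed simp
  \<comment> \<open>Induction invariant: the squares kept at level \<open>n\<close> carry the
    weights \<open>d n j\<close>, and \<open>step\<close> allows them to pay for the squares with
    weights \<open>c (Suc n) j\<close> subtracted at the next level.\<close>
  have main: "(\<Sum>j=1..n. d n j * (W j n)\<^sup>2) / 2
        \<le> (\<Sum>i=1..n. w i * (\<Sum>k=1..i. B i k * w k))" if "n \<le> N" for n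
    using that
  proof (induction n)
    case (Suc n)
    let ?w = "w (Suc n)" and ?c = "c (Suc n)"
    \<comment> \<open>The new square collects the whole term \<open>j = Suc n\<close>, hence the
      factor 2 under the common half, and the squares of \<open>?w\<close> left over from all
      \<open>j \<le> n\<close>, whose weights sum to \<open>B (Suc n) n\<close> by
      \<open>tel\<close>.\<close>
    have dn: "d (Suc n) (Suc n) = 2 * ?c (Suc n) + (if n = 0 then 0 else B (Suc n) n)"
      by (simp add: d_def c_def)
    have "?w * (\<Sum>k=1..Suc n. B (Suc n) k * w k)
        = (\<Sum>j=1..n. ?c j * (W j (Suc n) * ?w)) + ?c (Suc n) * ?w\<^sup>2"
      by (subst abel) (simp add: W_def sum_distrib_left algebra_simps power2_eq_square)
    also have "(\<Sum>j=1..n. ?c j * (W j (Suc n) * ?w))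
        = (\<Sum>j=1..n. ?c j * (W j (Suc n))\<^sup>2 / 2 - ?c j * (W j n)\<^sup>2 / 2 + ?c j * (?w\<^sup>2 / 2))"
      by (intro sum.cong) (auto simp: W_Suc power2_eq_square field_simps)
    also have "\<dots> = (\<Sum>j=1..n. ?c j * (W j (Suc n))\<^sup>2) / 2 - (\<Sum>j=1..n. ?c j * (W j n)\<^sup>2) / 2
        + (\<Sum>j=1..n. ?c j) * (?w\<^sup>2 / 2)"
      by (simp add: sum.distrib sum_subtractf sum_distrib_right sum_divide_distrib)
    finally have inc: "?w * (\<Sum>k=1..Suc n. B (Suc n) k * w k)
        = (\<Sum>j=1..n. ?c j * (W j (Suc n))\<^sup>2) / 2 - (\<Sum>j=1..n. ?c j * (W j n)\<^sup>2) / 2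
        + d (Suc n) (Suc n) * ?w\<^sup>2 / 2"
      unfolding tel dn by (simp add: field_simps)
    have "(\<Sum>j=1..n. ?c j * (W j n)\<^sup>2) \<le> (\<Sum>j=1..n. d n j * (W j n)\<^sup>2)"
      using Suc.prems by (intro sum_mono mult_right_mono step) auto
    moreover have "(\<Sum>j=1..Suc n. d (Suc n) j * (W j (Suc n))\<^sup>2)
        = (\<Sum>j=1..n. ?c j * (W j (Suc n))\<^sup>2) + d (Suc n) (Suc n) * ?w\<^sup>2"
      by (simp add: W_def) (simp add: d_def)
    moreover have "(\<Sum>i=1..Suc n. w i * (\<Sum>k=1..i. B i k * w k))
        = (\<Sum>i=1..n. w i * (\<Sum>k=1..i. B i k * w k)) + ?w * (\<Sum>k=1..Suc n. B (Suc n) k * w k)"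
      by simp
    ultimately show ?case using Suc.IH Suc.prems inc by simp
  qed simp
  have "0 \<le> (\<Sum>j=1..N. d N j * (W j N)\<^sup>2) / 2"
    using last by (intro divide_nonneg_pos sum_nonneg mult_nonneg_nonneg) auto
  then show ?thesis using main[of N] by simp
qed

subsection \<open>Cell integrals of increasing convex functions\<close>

text \<open>The domain is the whole ray up to \<open>b\<close>, so that one hypothesis covers all
  earlier cells. The derivative is explicit because its endpoint values enter the estimates; it is
  two-sided at \<open>b\<close>, which suits kernels whose singularity lies strictly to the
  right.\<close>

definition increasing_convex :: "(real \<Rightarrow> real) \<Rightarrow> (real \<Rightarrow> real) \<Rightarrow> real \<Rightarrow> bool" where
  "increasing_convex p p' b \<longleftrightarrow>
     (\<forall>s\<le>b. (p has_real_derivative p' s) (at s) \<and> 0 \<le> p' s) \<and>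
     (\<forall>s u. s \<le> u \<longrightarrow> u \<le> b \<longrightarrow> p' s \<le> p' u)"

lemma increasing_convex_subset:
  "increasing_convex p p' b \<Longrightarrow> a \<le> b \<Longrightarrow> increasing_convex p p' a"
  unfolding increasing_convex_def by fastforce

lemma increasing_convex_continuous:
  assumes "increasing_convex p p' b"
  shows "continuous_on {a..b} p"
  using assms unfolding increasing_convex_def
  by (intro continuous_at_imp_continuous_on) (auto intro: DERIV_isCont)

lemma increasing_convex_secant:
  assumes "increasing_convex p p' b" "s \<le> u" "u \<le> b"
  shows "p' s * (u - s) \<le> p u - p s" "p u - p s \<le> p' u * (u - s)"
proof -
  have "\<exists>z. s \<le> z \<and> z \<le> u \<and> p u - p s = p' z * (u - s)"
  proof (cases "s = u")
    case False
    then have "s < u" using assms by simp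
    moreover have "(p has_real_derivative p' x) (at x)" if "s \<le> x" "x \<le> u" for x
      using that assms unfolding increasing_convex_def by auto
    ultimately obtain z where "s < z" "z < u" "p u - p s = (u - s) * p' z"
      using MVT2[of s u p p'] by blast
    then show ?thesis by (intro exI[of _ z]) auto
  qed auto
  then obtain z where z: "s \<le> z" "z \<le> u" "p u - p s = p' z * (u - s)" by blast
  have "p' s \<le> p' z" "p' z \<le> p' u"
    using z assms unfolding increasing_convex_def by auto
  with z(3) assms(2) show "p' s * (u - s) \<le> p u - p s" "p u - p s \<le> p' u * (u - s)"
    by (simp_all add: mult_right_mono)
qed

lemma increasing_convex_mono:
  assumes "increasing_convex p p' b" "s \<le> u" "u \<le> b"
  shows "p s \<le> p u"
proof -
  have "0 \<le> p' s" using assms unfolding increasing_convex_def by auto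
  then have "0 \<le> p' s * (u - s)" using assms by simp
  then show ?thesis using increasing_convex_secant(1)[OF assms] by simp
qed

lemma has_integral_centered:
  fixes a b :: real assumes "a \<le> b"
  shows "((\<lambda>s. s - (b + a) / 2) has_integral 0) {a..b}"
proof -
  have "((\<lambda>s. s - (b + a) / 2) has_integral
      ((b - (b + a) / 2)\<^sup>2 / 2 - (a - (b + a) / 2)\<^sup>2 / 2)) {a..b}"
    by (rule fundamental_theorem_of_calculus[OF assms])
       (auto simp flip: has_real_derivative_iff_has_vector_derivative
             intro!: derivative_eq_intros)
  then show ?thesis by (simp add: power2_eq_square field_simps)
qed

lemma has_integral_centered_square:
  fixes a b :: real assumes "a \<le> b"
  shows "((\<lambda>s. (s - (b + a) / 2)\<^sup>2) has_integral (b - a) ^ 3 / 12) {a..b}"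
proof -
  have "((\<lambda>s. (s - (b + a) / 2)\<^sup>2) has_integral
      ((b - (b + a) / 2) ^ 3 / 3 - (a - (b + a) / 2) ^ 3 / 3)) {a..b}"
    by (rule fundamental_theorem_of_calculus[OF assms])
       (auto simp flip: has_real_derivative_iff_has_vector_derivative
             intro!: derivative_eq_intros)
  moreover have "(b - (b + a) / 2) ^ 3 / 3 - (a - (b + a) / 2) ^ 3 / 3 = (b - a) ^ 3 / 12"
    by (simp add: power3_eq_cube field_simps)
  ultimately show ?thesis by simp
qed

text \<open>The centered weight has integral zero, so a constant may be subtracted from
  \<open>p\<close> freely. This permits normalizing \<open>p\<close> at the midpoint or at the left
  end of the cell.\<close>

lemma has_integral_centered_mult:
  fixes p :: "real \<Rightarrow> real"
  assumes "continuous_on {a..b} p" "a \<le> b"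
  shows "((\<lambda>s. (s - (b + a) / 2) * (p s - k)) has_integral
      integral {a..b} (\<lambda>s. (s - (b + a) / 2) * p s)) {a..b}"
proof -
  have "((\<lambda>s. (s - (b + a) / 2) * p s - (s - (b + a) / 2) * k) has_integral
      (integral {a..b} (\<lambda>s. (s - (b + a) / 2) * p s) - 0 * k)) {a..b}"
    using assms
    by (intro has_integral_diff has_integral_mult_left has_integral_centered integrable_integral
        integrable_continuous_interval continuous_intros)
  then show ?thesis by (simp add: right_diff_distrib)
qed

text \<open>After subtracting the midpoint value of \<open>p\<close>, both factors of the integrand
  have the same sign.\<close>

lemma centered_integral_nonneg:
  assumes "increasing_convex p p' b" "a \<le> b"
  shows "0 \<le> integral {a..b} (\<lambda>s. (s - (b + a) / 2) * p s)"
proof (rule has_integral_nonneg)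
  show "((\<lambda>s. (s - (b + a) / 2) * (p s - p ((b + a) / 2))) has_integral
      integral {a..b} (\<lambda>s. (s - (b + a) / 2) * p s)) {a..b}"
    by (rule has_integral_centered_mult[OF increasing_convex_continuous[OF assms(1)] assms(2)])
  fix s assume s: "s \<in> {a..b}"
  show "0 \<le> (s - (b + a) / 2) * (p s - p ((b + a) / 2))"
  proof (cases "s \<le> (b + a) / 2")
    case True
    then show ?thesis
      using increasing_convex_mono[OF assms(1) True] assms by (simp add: mult_nonpos_nonpos)
  next
    case False
    then show ?thesis
      using increasing_convex_mono[OF assms(1), of "(b + a) / 2" s] s by simp
  qed
qed

text \<open>The largest slope on the cell is \<open>p' b\<close>, so the normalized integrand is at
  most \<open>p' b\<close> times the squared distance to the midpoint; the 12 comes from the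
  integral of that square.\<close>

lemma centered_integral_le:
  assumes "increasing_convex p p' b" "a \<le> b"
  shows "integral {a..b} (\<lambda>s. (s - (b + a) / 2) * p s) \<le> p' b * (b - a) ^ 3 / 12"
proof -
  define m where "m = (b + a) / 2"
  have m: "a \<le> m" "m \<le> b" using assms(2) by (auto simp: m_def)
  have up: "((\<lambda>s. p' b * (s - m)\<^sup>2) has_integral p' b * ((b - a) ^ 3 / 12)) {a..b}"
    unfolding m_def using has_integral_centered_square[OF assms(2)] by (rule has_integral_mult_right)
  have le: "(s - m) * (p s - p m) \<le> p' b * (s - m)\<^sup>2" if s: "s \<in> {a..b}" for s
  proof (cases "s \<le> m")
    case True
    have "p m - p s \<le> p' m * (m - s)"
      using increasing_convex_secant(2)[OF assms(1) True] m by simp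
    also have "\<dots> \<le> p' b * (m - s)"
      using True m assms unfolding increasing_convex_def by (intro mult_right_mono) auto
    finally have "(m - s) * (p m - p s) \<le> (m - s) * (p' b * (m - s))"
      using True by (intro mult_left_mono) auto
    then show ?thesis by (simp add: power2_eq_square algebra_simps)
  next
    case False
    have "p s - p m \<le> p' s * (s - m)"
      using increasing_convex_secant(2)[OF assms(1), of m s] False s by simp
    also have "\<dots> \<le> p' b * (s - m)"
      using False s assms unfolding increasing_convex_def by (intro mult_right_mono) auto
    finally have "(s - m) * (p s - p m) \<le> (s - m) * (p' b * (s - m))"
      using False by (intro mult_left_mono) auto
    then show ?thesis by (simp add: power2_eq_square algebra_simps)
  qed
  have mo: "((\<lambda>s. (s - m) * (p s - p m)) has_integral
      integral {a..b} (\<lambda>s. (s - m) * p s)) {a..b}"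
    unfolding m_def
    by (rule has_integral_centered_mult[OF increasing_convex_continuous[OF assms(1)] assms(2)])
  from has_integral_le[OF mo up le] show ?thesis
    by (simp add: m_def)
qed

text \<open>To the left of \<open>b\<close>, \<open>p\<close> stays below the line through its value
  at \<open>b\<close> with the smallest slope \<open>p' a\<close>. The mean of that line is its
  midpoint value.\<close>

lemma mean_upper:
  assumes "increasing_convex p p' b" "a < b"
  shows "integral {a..b} p / (b - a) \<le> p b - p' a * (b - a) / 2"
proof -
  have 1: "(p has_integral integral {a..b} p) {a..b}"
    by (intro integrable_integral integrable_continuous_interval
        increasing_convex_continuous[OF assms(1)])
  have 2: "((\<lambda>s. (p b - p' a * (b - a) / 2) + p' a * (s - (b + a) / 2)) has_integral
      ((p b - p' a * (b - a) / 2) * (b - a) + p' a * 0)) {a..b}"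
    using has_integral_const_real[of "p b - p' a * (b - a) / 2" a b] assms
    by (intro has_integral_add has_integral_mult_right has_integral_centered) (auto simp: mult.commute)
  have "p s \<le> (p b - p' a * (b - a) / 2) + p' a * (s - (b + a) / 2)" if s: "s \<in> {a..b}" for s
  proof -
    have "p' a * (b - s) \<le> p' s * (b - s)"
      using s assms unfolding increasing_convex_def by (intro mult_right_mono) auto
    also have "\<dots> \<le> p b - p s" using increasing_convex_secant(1)[OF assms(1)] s by auto
    finally show ?thesis by (simp add: field_simps)
  qed
  from has_integral_le[OF 1 2 this] show ?thesis
    using assms by (simp add: pos_divide_le_eq)
qed

text \<open>Mean minus moment is a weighted average of \<open>p\<close>: the weight is proportional
  to \<open>(b - a + d) - 2 * (s - (b + a) / 2)\<close>, which is at least \<open>d\<close> on the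
  cell. An average of an increasing function is at least its value at the left end. Here
  \<open>d\<close> plays the role of the next step size.\<close>

lemma mean_minus_moment_lower:
  assumes "increasing_convex p p' b" "a < b" "0 \<le> d"
  shows "p a \<le> integral {a..b} p / (b - a)
      - 2 / ((b - a) * (b - a + d)) * integral {a..b} (\<lambda>s. (s - (b + a) / 2) * p s)"
proof -
  let ?m = "(b + a) / 2"
  let ?I = "integral {a..b} p" and ?J = "integral {a..b} (\<lambda>s. (s - ?m) * p s)"
  have cont: "continuous_on {a..b} p" by (rule increasing_convex_continuous[OF assms(1)])
  have "((\<lambda>s. (b - a + d) * (p s - p a) - 2 * ((s - ?m) * (p s - p a))) has_integral
      ((b - a + d) * (?I - p a * (b - a)) - 2 * ?J)) {a..b}"
    using cont assms has_integral_const_real[of "p a" a b]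
    by (intro has_integral_diff has_integral_mult_right has_integral_centered_mult integrable_integral
         integrable_continuous_interval) (auto simp: mult.commute)
  moreover have "0 \<le> (b - a + d) * (p s - p a) - 2 * ((s - ?m) * (p s - p a))"
    if s: "s \<in> {a..b}" for s
  proof -
    have "0 \<le> ((b - a + d) - 2 * (s - ?m)) * (p s - p a)"
      using s assms increasing_convex_mono[OF assms(1), of a s]
      by (intro mult_nonneg_nonneg) (auto simp: field_simps)
    then show ?thesis by (simp add: algebra_simps)
  qed
  ultimately have "0 \<le> (b - a + d) * (?I - p a * (b - a)) - 2 * ?J"
    by (rule has_integral_nonneg)
  moreover have "p a \<le> x / e - 2 / (e * D) * y"
    if "0 < e" "0 < D" "0 \<le> D * (x - p a * e) - 2 * y" for x y e D :: real
    using that by (simp add: field_simps)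
  ultimately show ?thesis using assms by auto
qed

subsection \<open>The power kernel\<close>

lemma has_derivative_powr_reflected:
  fixes c e s :: real assumes "s < c"
  shows "((\<lambda>s. (c - s) powr e) has_real_derivative (- e * (c - s) powr (e - 1))) (at s)"
  using assms by (auto intro!: derivative_eq_intros)

text \<open>A decreasing convex power flattens to the right, so its drop over a fixed distance
  \<open>d\<close> shrinks. With exponent \<open>- \<alpha> - 1\<close> this gives the convexity of
  a difference of two kernels.\<close>

lemma powr_gap_antimono:
  fixes e d x y :: real
  assumes "e \<le> 0" "0 \<le> d" "0 < x" "x \<le> y"
  shows "y powr e - (y + d) powr e \<le> x powr e - (x + d) powr e"
proof (rule DERIV_nonpos_imp_nonincreasing[OF assms(4)])
  fix z assume z: "x \<le> z" "z \<le> y"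
  have "((\<lambda>x. x powr e - (x + d) powr e) has_real_derivative
      (e * (z powr (e - 1) - (z + d) powr (e - 1)))) (at z)"
    using z assms by (auto intro!: derivative_eq_intros simp: algebra_simps)
  moreover have "e * (z powr (e - 1) - (z + d) powr (e - 1)) \<le> 0"
    using z assms by (intro mult_nonpos_nonneg) (auto intro!: powr_mono2')
  ultimately show "\<exists>D. ((\<lambda>x. x powr e - (x + d) powr e) has_real_derivative D) (at z) \<and> D \<le> 0"
    by blast
qed

text \<open>Minus the derivative of \<open>omega (1 - \<alpha>)\<close>, hence the slope in
  \<open>s\<close> of the reflected kernel \<open>omega (1 - \<alpha>) (c - s)\<close>.\<close>

definition omega_slope :: "real \<Rightarrow> real \<Rightarrow> real" where
  "omega_slope \<alpha> x = \<alpha> * x powr (- \<alpha> - 1) / Gamma (1 - \<alpha>)"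

lemma omega_deriv:
  assumes "s < c"
  shows "((\<lambda>s. omega (1 - \<alpha>) (c - s)) has_real_derivative omega_slope \<alpha> (c - s)) (at s)"
  using DERIV_cdivide[OF has_derivative_powr_reflected[OF assms, of "- \<alpha>"], of "Gamma (1 - \<alpha>)"]
  by (simp add: omega_def omega_slope_def)

lemma increasing_convex_omega:
  assumes "0 < \<alpha>" "\<alpha> < 1" "b < c"
  shows "increasing_convex (\<lambda>s. omega (1 - \<alpha>) (c - s)) (\<lambda>s. omega_slope \<alpha> (c - s)) b"
  unfolding increasing_convex_def
proof (intro conjI allI impI)
  have G: "0 < Gamma (1 - \<alpha>)" using assms by (intro Gamma_real_pos) auto
  fix s assume "s \<le> b"
  then show "((\<lambda>s. omega (1 - \<alpha>) (c - s)) has_real_derivative omega_slope \<alpha> (c - s)) (at s)"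
    using assms by (intro omega_deriv) auto
  show "0 \<le> omega_slope \<alpha> (c - s)" using assms G by (simp add: omega_slope_def)
next
  have G: "0 < Gamma (1 - \<alpha>)" using assms by (intro Gamma_real_pos) auto
  fix s u assume "s \<le> u" "u \<le> b"
  then show "omega_slope \<alpha> (c - s) \<le> omega_slope \<alpha> (c - u)"
    unfolding omega_slope_def using assms G
    by (intro divide_right_mono mult_left_mono powr_mono2') auto
qed

text \<open>The slope of the difference is the drop of \<open>omega_slope\<close> over the distance
  \<open>c' - c\<close>. It is nonnegative since \<open>omega_slope\<close> decreases, and it grows
  towards the singularity by \<open>powr_gap_antimono\<close>.\<close>

lemma increasing_convex_omega_diff:
  assumes "0 < \<alpha>" "\<alpha> < 1" "b < c" "c \<le> c'"
  shows "increasing_convex (\<lambda>s. omega (1 - \<alpha>) (c - s) - omega (1 - \<alpha>) (c' - s))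
      (\<lambda>s. omega_slope \<alpha> (c - s) - omega_slope \<alpha> (c' - s)) b"
  unfolding increasing_convex_def
proof (intro conjI allI impI)
  have G: "0 < Gamma (1 - \<alpha>)" using assms by (intro Gamma_real_pos) auto
  fix s assume s: "s \<le> b"
  then show "((\<lambda>s. omega (1 - \<alpha>) (c - s) - omega (1 - \<alpha>) (c' - s)) has_real_derivative
      (omega_slope \<alpha> (c - s) - omega_slope \<alpha> (c' - s))) (at s)"
    using assms by (intro DERIV_diff omega_deriv) auto
  have "omega_slope \<alpha> (c' - s) \<le> omega_slope \<alpha> (c - s)"
    unfolding omega_slope_def using assms G s
    by (intro divide_right_mono mult_left_mono powr_mono2') auto
  then show "0 \<le> omega_slope \<alpha> (c - s) - omega_slope \<alpha> (c' - s)" by simp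
next
  have G: "0 < Gamma (1 - \<alpha>)" using assms by (intro Gamma_real_pos) auto
  fix s u assume "s \<le> u" "u \<le> b"
  then have "(c - s) powr (- \<alpha> - 1) - (c - s + (c' - c)) powr (- \<alpha> - 1)
      \<le> (c - u) powr (- \<alpha> - 1) - (c - u + (c' - c)) powr (- \<alpha> - 1)"
    using assms by (intro powr_gap_antimono) auto
  then have "\<alpha> / Gamma (1 - \<alpha>) * ((c - s) powr (- \<alpha> - 1) - (c' - s) powr (- \<alpha> - 1))
      \<le> \<alpha> / Gamma (1 - \<alpha>) * ((c - u) powr (- \<alpha> - 1) - (c' - u) powr (- \<alpha> - 1))"
    using assms G by (intro mult_left_mono) auto
  then show "omega_slope \<alpha> (c - s) - omega_slope \<alpha> (c' - s)
      \<le> omega_slope \<alpha> (c - u) - omega_slope \<alpha> (c' - u)"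
    unfolding omega_slope_def by (simp add: right_diff_distrib)
qed

lemma Gamma_two_minus:
  fixes \<alpha> :: real assumes "\<alpha> < 1"
  shows "Gamma (2 - \<alpha>) = (1 - \<alpha>) * Gamma (1 - \<alpha>)"
proof -
  have "1 - \<alpha> \<notin> \<int>\<^sub>\<le>\<^sub>0" using assms by (auto elim!: nonpos_Ints_cases)
  then show ?thesis using Gamma_plus1[of "1 - \<alpha>"] by simp
qed

text \<open>The case \<open>b = c\<close> is included, where the kernel is singular at the right
  end; the fundamental theorem is therefore used with derivatives in the interior only.\<close>

lemma integral_omega:
  assumes "0 < \<alpha>" "\<alpha> < 1" "a \<le> b" "b \<le> c"
  shows "integral {a..b} (\<lambda>s. omega (1 - \<alpha>) (c - s))
      = ((c - a) powr (1 - \<alpha>) - (c - b) powr (1 - \<alpha>)) / Gamma (2 - \<alpha>)"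
proof -
  note G = Gamma_two_minus[OF assms(2)]
  let ?P = "\<lambda>s::real. - ((c - s) powr (1 - \<alpha>)) / Gamma (2 - \<alpha>)"
  have "((\<lambda>s. omega (1 - \<alpha>) (c - s)) has_integral (?P b - ?P a)) {a..b}"
  proof (rule fundamental_theorem_of_calculus_interior[OF assms(3)])
    show "continuous_on {a..b} ?P"
      using assms less_imp_neq[OF Gamma_real_pos[of "2 - \<alpha>"]]
      by (intro continuous_on_divide continuous_on_minus continuous_on_powr' continuous_on_diff
          continuous_on_const continuous_on_id) auto
    fix s assume "s \<in> {a<..<b}"
    then have sc: "s < c" using assms by auto
    have "- (- (1 - \<alpha>) * (c - s) powr (1 - \<alpha> - 1)) / Gamma (2 - \<alpha>) = omega (1 - \<alpha>) (c - s)"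
      unfolding G omega_def minus_mult_left[symmetric] minus_minus using assms by simp
    with DERIV_cdivide[OF DERIV_minus[OF has_derivative_powr_reflected[OF sc, of "1 - \<alpha>"]],
        of "Gamma (2 - \<alpha>)"]
    show "(?P has_vector_derivative omega (1 - \<alpha>) (c - s)) (at s)"
      by (simp only: has_real_derivative_iff_has_vector_derivative[symmetric])
  qed
  then show ?thesis by (simp add: integral_unique diff_divide_distrib)
qed

text \<open>Up to the factor \<open>\<tau> * Gamma (2 - \<alpha>)\<close>, the left side is the mean
  of the kernel over a cell of length \<open>\<tau>\<close> at distance \<open>y\<close> from the
  singularity, minus its value at the far end. It decreases in \<open>y\<close>, so the worst case
  is \<open>y = 0\<close>.\<close>

lemma omega_mean_excess_scaled:
  fixes \<alpha> \<tau> y :: real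
  assumes "0 < \<alpha>" "\<alpha> < 1" "0 < \<tau>" "0 \<le> y"
  shows "(\<tau> + y) powr (1 - \<alpha>) - y powr (1 - \<alpha>) - (1 - \<alpha>) * \<tau> * (\<tau> + y) powr (- \<alpha>)
      \<le> \<alpha> * \<tau> powr (1 - \<alpha>)"
proof -
  let ?g = "\<lambda>y. (\<tau> + y) powr (1 - \<alpha>) - y powr (1 - \<alpha>) - (1 - \<alpha>) * \<tau> * (\<tau> + y) powr (- \<alpha>)"
  have "?g y \<le> ?g 0"
  \<comment> \<open>At 0 the power \<open>y powr (1 - \<alpha>)\<close> is continuous but not
    differentiable, so the derivative is taken on the open interval. Its sign is the tangent
    inequality for the convex kernel.\<close>
  proof (rule DERIV_nonpos_imp_decreasing_open[OF assms(4)])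
    show "continuous_on {0..y} ?g"
      using assms by (intro continuous_intros continuous_on_powr') auto
    fix x assume x: "0 < x" "x < y"
    have d: "(?g has_real_derivative
       ((1 - \<alpha>) * ((\<tau> + x) powr (- \<alpha>) - x powr (- \<alpha>) + \<alpha> * (\<tau> + x) powr (- \<alpha> - 1) * \<tau>))) (at x)"
      using assms x by (auto intro!: derivative_eq_intros simp: algebra_simps)
    have "increasing_convex (\<lambda>s. omega (1 - \<alpha>) (\<tau> + x - s)) (\<lambda>s. omega_slope \<alpha> (\<tau> + x - s)) \<tau>"
      using assms x by (intro increasing_convex_omega) auto
    from increasing_convex_secant(1)[OF this, of 0 \<tau>]
    have "omega_slope \<alpha> (\<tau> + x) * \<tau> \<le> omega (1 - \<alpha>) x - omega (1 - \<alpha>) (\<tau> + x)"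
      using assms by simp
    then have "(\<tau> + x) powr (- \<alpha>) - x powr (- \<alpha>) + \<alpha> * (\<tau> + x) powr (- \<alpha> - 1) * \<tau> \<le> 0"
      using less_imp_neq[OF Gamma_real_pos[of "1 - \<alpha>"]] Gamma_real_pos[of "1 - \<alpha>"] assms
      by (simp add: omega_def omega_slope_def field_simps)
    with d assms show "\<exists>D. (?g has_real_derivative D) (at x) \<and> D \<le> 0"
      by (intro exI[of _ "(1 - \<alpha>) * ((\<tau> + x) powr (- \<alpha>) - x powr (- \<alpha>)
          + \<alpha> * (\<tau> + x) powr (- \<alpha> - 1) * \<tau>)"]) (auto intro: mult_nonneg_nonpos)
  qed
  also have "?g 0 = \<alpha> * \<tau> powr (1 - \<alpha>)"
    using assms by (simp add: powr_mult_base algebra_simps)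
  finally show ?thesis .
qed

text \<open>Compares the constant of \<open>omega_mean_excess_scaled\<close> with the one in the
  last coefficient \<open>acoef t \<alpha> n n\<close>, whose cell is cut off at the offset point.
  The proof passes through \<open>(1 / 2) powr (1 - \<alpha>)\<close>, using
  \<open>ln 2 \<le> 1\<close>.\<close>

lemma alpha_le_powr:
  fixes \<alpha> :: real
  assumes "0 < \<alpha>" "\<alpha> < 1"
  shows "\<alpha> \<le> (1 - \<alpha> / 2) powr (1 - \<alpha>)"
proof -
  have "ln 2 \<le> (1::real)" using ln_le_minus_one[of "2::real"] by simp
  then have "(1 - \<alpha>) * ln 2 \<le> (1 - \<alpha>) * 1" using assms by (intro mult_left_mono) auto
  then have "\<alpha> \<le> 1 + (1 - \<alpha>) * (- ln 2)" by simp
  also have "\<dots> \<le> exp ((1 - \<alpha>) * (- ln 2))" by (rule exp_ge_add_one_self)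
  also have "\<dots> = (1 / 2) powr (1 - \<alpha>)" by (simp add: powr_def ln_div)
  also have "\<dots> \<le> (1 - \<alpha> / 2) powr (1 - \<alpha>)" using assms by (intro powr_mono2) auto
  finally show ?thesis .
qed

subsection \<open>The convolution kernels on a mesh\<close>

definition mean :: "(nat \<Rightarrow> real) \<Rightarrow> (real \<Rightarrow> real) \<Rightarrow> nat \<Rightarrow> real" where
  "mean t p k = (1 / tau t k) * integral {t (k - 1)..t k} p"

definition moment :: "(nat \<Rightarrow> real) \<Rightarrow> (real \<Rightarrow> real) \<Rightarrow> nat \<Rightarrow> real" where
  "moment t p k = 2 / (tau t k * (tau t k + tau t (k + 1))) *
     integral {t (k - 1)..t k} (\<lambda>s. (s - (t k + t (k - 1)) / 2) * p s)"

text \<open>The contribution to \<open>c(n,j)\<close> of the cells \<open>j - 1\<close> and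
  \<open>j - 2\<close>; cell \<open>j\<close> itself contributes mean minus moment. The case
  distinctions reflect that no cell precedes the first one.\<close>

definition history :: "(nat \<Rightarrow> real) \<Rightarrow> (real \<Rightarrow> real) \<Rightarrow> nat \<Rightarrow> real" where
  "history t p j = (if j \<le> 1 then 0 else
     (1 + 1 / ratio t j) * moment t p (j - 1) - mean t p (j - 1)
     - (if j = 2 then 0 else moment t p (j - 2) / ratio t (j - 1)))"

lemma mean_diff:
  assumes "continuous_on {t (k - 1)..t k} p" "continuous_on {t (k - 1)..t k} q"
  shows "mean t (\<lambda>s. p s - q s) k = mean t p k - mean t q k"
  unfolding mean_def using assms
  by (subst integral_diff) (auto intro: integrable_continuous_interval simp: right_diff_distrib)

lemma moment_diff:
  assumes "continuous_on {t (k - 1)..t k} p" "continuous_on {t (k - 1)..t k} q"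
  shows "moment t (\<lambda>s. p s - q s) k = moment t p k - moment t q k"
proof -
  have "integral {t (k - 1)..t k} (\<lambda>s. (s - (t k + t (k - 1)) / 2) * p s
        - (s - (t k + t (k - 1)) / 2) * q s)
      = integral {t (k - 1)..t k} (\<lambda>s. (s - (t k + t (k - 1)) / 2) * p s)
        - integral {t (k - 1)..t k} (\<lambda>s. (s - (t k + t (k - 1)) / 2) * q s)"
    using assms by (intro integral_diff integrable_continuous_interval continuous_intros)
  then show ?thesis unfolding moment_def by (simp add: right_diff_distrib)
qed

abbreviation memory :: "(nat \<Rightarrow> real) \<Rightarrow> real \<Rightarrow> nat \<Rightarrow> real \<Rightarrow> real" where
  "memory t \<alpha> n s \<equiv> omega (1 - \<alpha>) (tsig t \<alpha> n - s)"

locale mesh =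
  fixes t :: "nat \<Rightarrow> real" and N :: nat
  assumes t_less: "\<And>k. 1 \<le> k \<Longrightarrow> k \<le> N \<Longrightarrow> t (k - 1) < t k"
    and ratio_ge: "\<And>k. 2 \<le> k \<Longrightarrow> k \<le> N \<Longrightarrow> 4 / 7 \<le> ratio t k"
begin

section \<open>Mesh functionals on increasing convex functions\<close>

lemma tau_pos: "1 \<le> k \<Longrightarrow> k \<le> N \<Longrightarrow> 0 < tau t k"
  using t_less by (simp add: tau_def)

lemma ratio_pos: "2 \<le> k \<Longrightarrow> k \<le> N \<Longrightarrow> 0 < ratio t k"
  using ratio_ge[of k] by simp

lemma t_mono: "i \<le> j \<Longrightarrow> j \<le> N \<Longrightarrow> t i \<le> t j"
proof (induction j)
  case (Suc j)
  then show ?case using t_less[of "Suc j"] by (cases "i = Suc j") auto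
qed simp

lemma history_diff:
  assumes "j \<le> N" "continuous_on {..t (j - 1)} p" "continuous_on {..t (j - 1)} q"
  shows "history t (\<lambda>s. p s - q s) j = history t p j - history t q j"
proof -
  have sub: "{t (k - 1)..t k} \<subseteq> {..t (j - 1)}" if "k \<le> j - 1" for k
    using t_mono[OF that] assms(1) by auto
  have "continuous_on {t (k - 1)..t k} p" "continuous_on {t (k - 1)..t k} q" if "k \<le> j - 1" for k
    using sub[OF that] assms continuous_on_subset by blast+
  then have "mean t (\<lambda>s. p s - q s) k = mean t p k - mean t q k"
    "moment t (\<lambda>s. p s - q s) k = moment t p k - moment t q k" if "k \<le> j - 1" for k
    using that by (simp_all only: mean_diff moment_diff)
  note this[of "j - 1", OF order_refl] this[of "j - 2"]
  then show ?thesis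
    unfolding history_def by (simp add: diff_divide_distrib distrib_right right_diff_distrib)
qed

lemma moment_nonneg:
  assumes "1 \<le> k" "k + 1 \<le> N" "increasing_convex p p' (t k)"
  shows "0 \<le> moment t p k"
  unfolding moment_def
  using centered_integral_nonneg[OF assms(3), of "t (k - 1)"] tau_pos[of k] tau_pos[of "k + 1"]
    t_less[of k] assms
  by (intro mult_nonneg_nonneg) auto

lemma mean_minus_moment_ge:
  assumes "1 \<le> k" "k + 1 \<le> N" "increasing_convex p p' (t k)"
  shows "p (t (k - 1)) \<le> mean t p k - moment t p k"
  using mean_minus_moment_lower[OF assms(3), of "t (k - 1)" "tau t (k + 1)"]
    tau_pos[of "k + 1"] t_less[of k] assms
  by (simp add: mean_def moment_def tau_def)

text \<open>The mean over the last cell leaves a reserve of half the cell size times the slope at its left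
  end; the ratio bound makes it dominate the moment over the preceding cell.\<close>

lemma history_ge:
  assumes "1 \<le> j" "j \<le> N" "increasing_convex p p' (t (j - 1))" "0 \<le> p (t (j - 1))"
  shows "- p (t (j - 1)) \<le> history t p j"
proof (cases "j = 1")
  case True
  then show ?thesis using assms by (simp add: history_def)
next
  case False
  then have "j = Suc (Suc (j - 2))" using assms(1) by simp
  then obtain i where j: "j = Suc (Suc i)" by blast
  let ?u = "tau t (Suc i)" and ?S = "p' (t i)"
  have ic: "increasing_convex p p' (t (Suc i))" using assms(3) by (simp add: j)
  have u: "0 < ?u" using assms(2) by (intro tau_pos) (auto simp: j)
  have less: "t i < t (Suc i)" using t_less[of "Suc i"] assms(2) by (simp add: j)
  have S: "0 \<le> ?S" using ic less unfolding increasing_convex_def by auto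
  have mom: "0 \<le> (1 + 1 / ratio t j) * moment t p (Suc i)"
    using moment_nonneg[OF _ _ ic] ratio_pos[of j] assms(2) by (auto simp: j)
  have mean: "mean t p (Suc i) \<le> p (t (Suc i)) - ?S * ?u / 2"
    using mean_upper[OF ic less] by (simp add: mean_def tau_def)
  \<comment> \<open>The only unfavorable moment, from the cell \<open>i\<close> of length
    \<open>?v\<close> before the cell \<open>Suc i\<close> of length \<open>?u\<close>. Its slopes
    are at most \<open>?S\<close>, the slope at the common node.\<close>
  have old: "moment t p i / ratio t (Suc i) \<le> ?S * ?u / 2" if "i \<noteq> 0"
  proof -
    obtain l where i: "i = Suc l" using \<open>i \<noteq> 0\<close> not0_implies_Suc by blast
    have ici: "increasing_convex p p' (t i)"
      using increasing_convex_subset[OF ic] less by simp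
    let ?v = "tau t i"
    have v: "0 < ?v" using assms(2) by (intro tau_pos) (auto simp: i j)
    have less': "t l \<le> t i" using t_less[of i] assms(2) by (simp add: i j)
    have r: "ratio t (Suc i) = ?u / ?v" by (simp add: ratio_def)
    have "4 / 7 \<le> ?u / ?v" using ratio_ge[of "Suc i"] assms(2) unfolding r by (simp add: i j)
    then have vu: "?v \<le> 7 / 4 * ?u" using v by (simp add: field_simps)
    have "integral {t l..t i} (\<lambda>s. (s - (t i + t l) / 2) * p s) \<le> ?S * ?v ^ 3 / 12"
      using centered_integral_le[OF ici less'] by (simp add: tau_def i)
    then have "moment t p i \<le> 2 / (?v * (?v + ?u)) * (?S * ?v ^ 3 / 12)"
      using u v by (simp only: moment_def i Suc_eq_plus1[symmetric] diff_Suc_1)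
        (intro mult_left_mono, auto)
    also have "\<dots> = ?S * ?v\<^sup>2 / (6 * (?v + ?u))"
    proof -
      have "2 / (?v * w) * (?S * ?v ^ 3 / 12) = ?S * ?v\<^sup>2 / (6 * w)" for w
        using v by (simp add: power2_eq_square power3_eq_cube)
      then show ?thesis .
    qed
    finally have "moment t p i / ratio t (Suc i) \<le> ?S * ?v\<^sup>2 / (6 * (?v + ?u)) / (?u / ?v)"
      unfolding r using u v by (intro divide_right_mono) auto
    also have "\<dots> = ?S * (?v ^ 3 / (6 * ?u * (?v + ?u)))"
      by (simp add: power2_eq_square power3_eq_cube mult_ac)
    \<comment> \<open>With \<open>x = ?v / ?u\<close> this is \<open>x ^ 3 \<le> 3 * x + 3\<close>,
      which holds for \<open>x \<le> 7 / 4\<close>, the bound given by the step ratio. The split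
      \<open>49 / 16 = 3 + 1 / 16\<close> matches the two terms on the right.\<close>
    also have "?v ^ 3 / (6 * ?u * (?v + ?u)) \<le> ?u / 2"
    proof -
      have "?v\<^sup>2 \<le> (7 / 4 * ?u)\<^sup>2" using vu v by (intro power_mono) auto
      then have "?v * ?v\<^sup>2 \<le> ?v * (49 / 16 * ?u\<^sup>2)" using v by (simp add: power2_eq_square)
      also have "\<dots> = 3 * ?v * ?u\<^sup>2 + ?u\<^sup>2 / 16 * ?v" by simp
      also have "\<dots> \<le> 3 * ?v * ?u\<^sup>2 + ?u\<^sup>2 / 16 * (7 / 4 * ?u)"
        using vu by (intro add_left_mono mult_left_mono) auto
      also have "\<dots> \<le> 3 * ?v * ?u\<^sup>2 + 3 * ?u ^ 3"
        using u by (simp add: power2_eq_square power3_eq_cube)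
      finally have "?v ^ 3 \<le> 3 * ?u\<^sup>2 * (?v + ?u)"
        by (simp add: power2_eq_square power3_eq_cube algebra_simps)
      then have "?v ^ 3 \<le> ?u / 2 * (6 * ?u * (?v + ?u))"
        by (simp add: power2_eq_square algebra_simps)
      then show ?thesis using u v by (subst pos_divide_le_eq) auto
    qed
    finally show ?thesis using S by (simp add: mult_left_mono)
  qed
  have "0 \<le> ?S * ?u / 2" using S u by simp
  then show ?thesis unfolding history_def using mom mean old by (cases "i = 0") (auto simp: j)
qed

text \<open>The lower bounds of the two parts, \<open>p (t (j - 1))\<close> for mean minus moment
  and its negative for the history, cancel exactly.\<close>

lemma mean_minus_moment_history_nonneg:
  assumes "1 \<le> j" "j + 1 \<le> N" "increasing_convex p p' (t j)" "0 \<le> p (t (j - 1))"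
  shows "0 \<le> mean t p j - moment t p j + history t p j"
proof -
  have "increasing_convex p p' (t (j - 1))"
    using increasing_convex_subset[OF assms(3)] t_less[of j] assms by simp
  then show ?thesis using history_ge[of j p p'] mean_minus_moment_ge[OF assms(1-3)] assms by simp
qed

section \<open>The coefficients expressed by mesh functionals\<close>

lemma tsig_bounds:
  assumes "0 < \<alpha>" "\<alpha> < 1" "1 \<le> n" "n \<le> N"
  shows "tsig t \<alpha> n = t (n - 1) + (1 - \<alpha> / 2) * tau t n"
    and "t (n - 1) < tsig t \<alpha> n" and "tsig t \<alpha> n < t n"
proof -
  show eq: "tsig t \<alpha> n = t (n - 1) + (1 - \<alpha> / 2) * tau t n"
    by (simp add: tsig_def tau_def algebra_simps)
  have pos: "0 < tau t n" using tau_pos assms by simp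
  then have "0 < (1 - \<alpha> / 2) * tau t n" using assms by simp
  then show "t (n - 1) < tsig t \<alpha> n" by (simp add: eq)
  have "(1 - \<alpha> / 2) * tau t n < 1 * tau t n" using assms pos by (intro mult_strict_right_mono) auto
  then show "tsig t \<alpha> n < t n" by (simp add: eq) (simp add: tau_def)
qed

lemma acoef_eq_mean:
  assumes "0 < \<alpha>" "\<alpha> < 1" "k < n" "n \<le> N"
  shows "acoef t \<alpha> n k = mean t (memory t \<alpha> n) k"
proof -
  have "t k \<le> t (n - 1)" using assms by (intro t_mono) auto
  also have "\<dots> < tsig t \<alpha> n" using assms by (intro tsig_bounds) auto
  finally show ?thesis by (simp add: acoef_def mean_def)
qed

lemma bcoef_eq_moment: "bcoef t \<alpha> n k = moment t (memory t \<alpha> n) k"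
  by (simp add: bcoef_def moment_def)

lemma Bcoef_diff:
  assumes "0 < \<alpha>" "\<alpha> < 1" "1 \<le> j" "j < n" "n \<le> N"
  shows "Bcoef t \<alpha> n j - (if j = 1 then 0 else Bcoef t \<alpha> n (j - 1))
      = mean t (memory t \<alpha> n) j - moment t (memory t \<alpha> n) j + history t (memory t \<alpha> n) j"
proof (cases "j = 1")
  case True
  then show ?thesis using assms by (simp add: Bcoef_def history_def acoef_eq_mean bcoef_eq_moment)
next
  case False
  then have "j = Suc (Suc (j - 2))" using assms(3) by simp
  then obtain i where j: "j = Suc (Suc i)" by blast
  show ?thesis using assms
    by (simp add: j Bcoef_def history_def acoef_eq_mean bcoef_eq_moment algebra_simps)
qed

text \<open>The last cell ends at the offset point, so its coefficient stays as
  \<open>acoef\<close>. Counting the diagonal entry twice doubles \<open>moment / ratio\<close> as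
  well: one copy belongs to the history, the other remains.\<close>

lemma Bcoef_last_diff:
  assumes "0 < \<alpha>" "\<alpha> < 1" "1 \<le> n" "n \<le> N"
  shows "Bcoef t \<alpha> n n - (if n = 1 then 0 else Bcoef t \<alpha> n (n - 1)) + Bcoef t \<alpha> n n
      = 2 * acoef t \<alpha> n n + history t (memory t \<alpha> n) n
        + (if n = 1 then 0 else moment t (memory t \<alpha> n) (n - 1) / ratio t n)"
proof (cases "n = 1")
  case True
  then show ?thesis by (simp add: Bcoef_def history_def)
next
  case False
  then have "n = Suc (Suc (n - 2))" using assms(3) by simp
  then obtain i where j: "n = Suc (Suc i)" by blast
  show ?thesis using assms
    by (simp add: j Bcoef_def history_def acoef_eq_mean bcoef_eq_moment algebra_simps)
qed

lemma acoef_last: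
  assumes "0 < \<alpha>" "\<alpha> < 1" "1 \<le> n" "n \<le> N"
  shows "acoef t \<alpha> n n = ((1 - \<alpha> / 2) * tau t n) powr (1 - \<alpha>) / (tau t n * Gamma (2 - \<alpha>))"
  using tsig_bounds[OF assms] assms
  by (simp add: acoef_def integral_omega)

text \<open>The quotient of the two sides is \<open>(1 - \<alpha> / 2) / (1 - \<alpha>)\<close>,
  which is at least 1.\<close>

lemma acoef_last_ge_memory:
  assumes "0 < \<alpha>" "\<alpha> < 1" "1 \<le> n" "n \<le> N"
  shows "memory t \<alpha> n (t (n - 1)) \<le> acoef t \<alpha> n n"
proof -
  let ?z = "1 - \<alpha> / 2" and ?T = "tau t n"
  have T: "0 < ?T" using tau_pos assms by simp
  have G: "0 < Gamma (1 - \<alpha>)" using assms by (intro Gamma_real_pos) auto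
  have "memory t \<alpha> n (t (n - 1)) = (?z * ?T) powr (- \<alpha>) / Gamma (1 - \<alpha>)"
    by (simp add: tsig_bounds(1)[OF assms] omega_def)
  also have "\<dots> \<le> (?z * ?T) powr (- \<alpha>) / Gamma (1 - \<alpha>) * (?z / (1 - \<alpha>))"
    using mult_left_mono[of 1 "?z / (1 - \<alpha>)" "(?z * ?T) powr (- \<alpha>) / Gamma (1 - \<alpha>)"] assms G
    by (simp add: le_divide_eq)
  also have "\<dots> = (?z * ?T) powr (1 - \<alpha>) / (?T * Gamma (2 - \<alpha>))"
  proof -
    have "(?z * ?T) powr (1 - \<alpha>) = (?z * ?T) * (?z * ?T) powr (- \<alpha>)"
      using T assms by (simp add: powr_mult_base)
    then show ?thesis using T by (simp add: Gamma_two_minus[OF assms(2)] mult_ac)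
  qed
  finally show ?thesis by (simp add: acoef_last[OF assms])
qed

text \<open>Cell \<open>n\<close> lies at distance \<open>y\<close> from the next offset point, so
  \<open>omega_mean_excess_scaled\<close> bounds the excess and \<open>alpha_le_powr\<close>
  compares the constants.\<close>

lemma mean_memory_next_le:
  assumes "0 < \<alpha>" "\<alpha> < 1" "1 \<le> n" "n + 1 \<le> N"
  shows "mean t (memory t \<alpha> (n + 1)) n - memory t \<alpha> (n + 1) (t (n - 1)) \<le> acoef t \<alpha> n n"
proof -
  let ?T = "tau t n"
  define y where "y = (1 - \<alpha> / 2) * tau t (n + 1)"
  have T: "0 < ?T" using tau_pos assms by simp
  have y: "0 < y" using tau_pos[of "n + 1"] assms by (simp add: y_def)
  have G: "0 < Gamma (2 - \<alpha>)" using assms by (intro Gamma_real_pos) auto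
  have G1: "0 < Gamma (1 - \<alpha>)" using assms by (intro Gamma_real_pos) auto
  have c: "tsig t \<alpha> (n + 1) = t n + y" using tsig_bounds(1)[of \<alpha> "n + 1"] assms by (simp add: y_def)
  have c': "t n + y - t (n - 1) = ?T + y" by (simp add: tau_def)
  have m: "mean t (memory t \<alpha> (n + 1)) n = ((?T + y) powr (1 - \<alpha>) - y powr (1 - \<alpha>)) / (?T * Gamma (2 - \<alpha>))"
    unfolding mean_def c using assms y t_less[of n] by (subst integral_omega) (auto simp: c'[unfolded One_nat_def])
  have "memory t \<alpha> (n + 1) (t (n - 1)) = (?T + y) powr (- \<alpha>) / Gamma (1 - \<alpha>)"
    unfolding c omega_def c' by simp
  also have "\<dots> = (1 - \<alpha>) * ?T * (?T + y) powr (- \<alpha>) / (?T * Gamma (2 - \<alpha>))"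
    using T assms by (simp add: Gamma_two_minus[OF assms(2)])
  finally have "mean t (memory t \<alpha> (n + 1)) n - memory t \<alpha> (n + 1) (t (n - 1))
      = ((?T + y) powr (1 - \<alpha>) - y powr (1 - \<alpha>) - (1 - \<alpha>) * ?T * (?T + y) powr (- \<alpha>))
        / (?T * Gamma (2 - \<alpha>))"
    unfolding m by (simp add: diff_divide_distrib)
  also have "\<dots> \<le> \<alpha> * ?T powr (1 - \<alpha>) / (?T * Gamma (2 - \<alpha>))"
    using omega_mean_excess_scaled[of \<alpha> ?T y] assms T y G by (intro divide_right_mono) auto
  also have "\<dots> \<le> (1 - \<alpha> / 2) powr (1 - \<alpha>) * ?T powr (1 - \<alpha>) / (?T * Gamma (2 - \<alpha>))"
    using alpha_le_powr[of \<alpha>] assms T G by (intro divide_right_mono mult_right_mono) auto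
  also have "\<dots> = acoef t \<alpha> n n"
    using acoef_last[of \<alpha> n] assms T by (simp add: powr_mult)
  finally show ?thesis .
qed

section \<open>Memory kernels and the sign conditions on the coefficients\<close>

lemma memory_nonneg: "\<alpha> < 1 \<Longrightarrow> 0 \<le> memory t \<alpha> n s"
  using Gamma_real_pos[of "1 - \<alpha>"] by (simp add: omega_def)

lemma increasing_convex_memory:
  assumes "0 < \<alpha>" "\<alpha> < 1" "k < n" "n \<le> N"
  shows "increasing_convex (memory t \<alpha> n) (\<lambda>s. omega_slope \<alpha> (tsig t \<alpha> n - s)) (t k)"
proof -
  have "t k \<le> t (n - 1)" using assms by (intro t_mono) auto
  also have "\<dots> < tsig t \<alpha> n" using assms by (intro tsig_bounds) auto
  finally show ?thesis using assms by (intro increasing_convex_omega)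
qed

lemma increasing_convex_memory_diff:
  assumes "0 < \<alpha>" "\<alpha> < 1" "k < n" "n + 1 \<le> N"
  shows "increasing_convex (\<lambda>s. memory t \<alpha> n s - memory t \<alpha> (n + 1) s)
      (\<lambda>s. omega_slope \<alpha> (tsig t \<alpha> n - s) - omega_slope \<alpha> (tsig t \<alpha> (n + 1) - s)) (t k)"
    and "s \<le> t k \<Longrightarrow> memory t \<alpha> (n + 1) s \<le> memory t \<alpha> n s"
proof -
  have "t k \<le> t (n - 1)" using assms by (intro t_mono) auto
  also have less: "t (n - 1) < tsig t \<alpha> n" using assms by (intro tsig_bounds) auto
  finally have 1: "t k < tsig t \<alpha> n" .
  have "tsig t \<alpha> n < t n" using assms by (intro tsig_bounds) auto
  also have "t n < tsig t \<alpha> (n + 1)" using tsig_bounds(2)[of \<alpha> "n + 1"] assms by simp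
  finally have 2: "tsig t \<alpha> n < tsig t \<alpha> (n + 1)" .
  show "increasing_convex (\<lambda>s. memory t \<alpha> n s - memory t \<alpha> (n + 1) s)
      (\<lambda>s. omega_slope \<alpha> (tsig t \<alpha> n - s) - omega_slope \<alpha> (tsig t \<alpha> (n + 1) - s)) (t k)"
    using assms 1 2 by (intro increasing_convex_omega_diff) auto
  show "memory t \<alpha> (n + 1) s \<le> memory t \<alpha> n s" if "s \<le> t k"
    using that assms 1 2 Gamma_real_pos[of "1 - \<alpha>"] unfolding omega_def
    by (intro divide_right_mono powr_mono2') auto
qed

lemma continuous_on_memory:
  assumes "0 < \<alpha>" "\<alpha> < 1" "k < n" "n \<le> N"
  shows "continuous_on {..t k} (memory t \<alpha> n)"
  using increasing_convex_memory[OF assms] unfolding increasing_convex_def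
  by (intro continuous_at_imp_continuous_on) (auto intro: DERIV_isCont)

text \<open>By linearity the gap is the nonnegative functional applied to the difference of the
  memory kernels of levels \<open>n\<close> and \<open>n + 1\<close>, which is increasing and convex
  up to \<open>t j\<close>.\<close>

lemma Bcoef_diff_antimono:
  assumes "0 < \<alpha>" "\<alpha> < 1" "1 \<le> j" "j < n" "n + 1 \<le> N"
  shows "Bcoef t \<alpha> (n + 1) j - (if j = 1 then 0 else Bcoef t \<alpha> (n + 1) (j - 1))
      \<le> Bcoef t \<alpha> n j - (if j = 1 then 0 else Bcoef t \<alpha> n (j - 1))"
proof -
  let ?p = "memory t \<alpha> n" and ?q = "memory t \<alpha> (n + 1)"
  let ?d = "\<lambda>s. ?p s - ?q s"
  have jN: "j \<le> N" using assms by simp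
  have cont: "continuous_on {..t k} ?p" "continuous_on {..t k} ?q" if "k \<le> j" for k
    using that assms by (auto intro!: continuous_on_memory)
  have sub: "continuous_on {t (j - 1)..t j} ?p" "continuous_on {t (j - 1)..t j} ?q"
    using cont[of j] by (auto intro: continuous_on_subset)
  have "0 \<le> mean t ?d j - moment t ?d j + history t ?d j"
    using assms increasing_convex_memory_diff(1)[of \<alpha> j n]
      increasing_convex_memory_diff(2)[of \<alpha> j n "t (j - 1)"] t_less[of j]
    by (intro mean_minus_moment_history_nonneg) auto
  also have "\<dots> = (mean t ?p j - moment t ?p j + history t ?p j)
      - (mean t ?q j - moment t ?q j + history t ?q j)"
    unfolding mean_diff[OF sub] moment_diff[OF sub] history_diff[OF jN cont[OF diff_le_self]]
    by simp
  finally show ?thesis using assms by (simp only: Bcoef_diff)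
qed

text \<open>On the diagonal the kernel of level \<open>n\<close> is singular inside cell
  \<open>n\<close>, so only the histories are compared through the kernel difference. Of the two
  copies of \<open>acoef t \<alpha> n n\<close>, one pays for \<open>?p (t (n - 1))\<close> and the
  other for the mean of \<open>?q\<close> above its value at the left end; the values of
  \<open>?q\<close> cancel.\<close>

lemma Bcoef_last_ge:
  assumes "0 < \<alpha>" "\<alpha> < 1" "1 \<le> n" "n + 1 \<le> N"
  shows "Bcoef t \<alpha> (n + 1) n - (if n = 1 then 0 else Bcoef t \<alpha> (n + 1) (n - 1))
      \<le> Bcoef t \<alpha> n n - (if n = 1 then 0 else Bcoef t \<alpha> n (n - 1)) + Bcoef t \<alpha> n n"
proof -
  let ?p = "memory t \<alpha> n" and ?q = "memory t \<alpha> (n + 1)"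
  let ?d = "\<lambda>s. ?p s - ?q s"
  have n: "n \<le> N" using assms by simp
  have cont: "continuous_on {..t (n - 1)} ?p" "continuous_on {..t (n - 1)} ?q"
    using assms by (auto intro!: continuous_on_memory)
  have "- ?d (t (n - 1)) \<le> history t ?d n"
    using assms increasing_convex_memory_diff(1)[of \<alpha> "n - 1" n]
      increasing_convex_memory_diff(2)[of \<alpha> "n - 1" n "t (n - 1)"]
    by (intro history_ge) auto
  then have "?q (t (n - 1)) - ?p (t (n - 1)) \<le> history t ?p n - history t ?q n"
    unfolding history_diff[OF n cont] by simp
  moreover have "0 \<le> (if n = 1 then 0 else moment t ?p (n - 1) / ratio t n)"
    using assms moment_nonneg[of "n - 1", OF _ _ increasing_convex_memory[of \<alpha> "n - 1" n]]
      ratio_pos[of n] by auto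
  moreover have "0 \<le> moment t ?q n"
    using assms moment_nonneg[of n, OF _ _ increasing_convex_memory[of \<alpha> n "n + 1"]] by auto
  moreover have "?p (t (n - 1)) \<le> acoef t \<alpha> n n"
    using assms by (intro acoef_last_ge_memory) auto
  moreover have "mean t ?q n - ?q (t (n - 1)) \<le> acoef t \<alpha> n n"
    using assms by (intro mean_memory_next_le) auto
  moreover have "Bcoef t \<alpha> (n + 1) n - (if n = 1 then 0 else Bcoef t \<alpha> (n + 1) (n - 1))
      = mean t ?q n - moment t ?q n + history t ?q n"
    using assms by (intro Bcoef_diff) auto
  ultimately show ?thesis unfolding Bcoef_last_diff[OF assms(1-3) n] by linarith
qed

lemma Bcoef_last_nonneg:
  assumes "0 < \<alpha>" "\<alpha> < 1" "1 \<le> n" "n \<le> N"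
  shows "0 \<le> Bcoef t \<alpha> n n - (if n = 1 then 0 else Bcoef t \<alpha> n (n - 1)) + Bcoef t \<alpha> n n"
proof -
  let ?p = "memory t \<alpha> n"
  have "- ?p (t (n - 1)) \<le> history t ?p n"
    using assms increasing_convex_memory[of \<alpha> "n - 1" n] memory_nonneg[of \<alpha>]
    by (intro history_ge) auto
  moreover have "0 \<le> (if n = 1 then 0 else moment t ?p (n - 1) / ratio t n)"
    using assms moment_nonneg[of "n - 1", OF _ _ increasing_convex_memory[of \<alpha> "n - 1" n]]
      ratio_pos[of n] by auto
  moreover have "?p (t (n - 1)) \<le> acoef t \<alpha> n n" "0 \<le> ?p (t (n - 1))"
    using assms acoef_last_ge_memory memory_nonneg by auto
  ultimately show ?thesis unfolding Bcoef_last_diff[OF assms] by linarith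
qed

lemma Bcoef_diff_nonneg:
  assumes "0 < \<alpha>" "\<alpha> < 1" "1 \<le> j" "j < n" "n \<le> N"
  shows "0 \<le> Bcoef t \<alpha> n j - (if j = 1 then 0 else Bcoef t \<alpha> n (j - 1))"
  unfolding Bcoef_diff[OF assms]
  using assms increasing_convex_memory[of \<alpha> j n] memory_nonneg[of \<alpha>]
  by (intro mean_minus_moment_history_nonneg) auto

lemma Bcoef_form_nonneg:
  assumes "0 < \<alpha>" "\<alpha> < 1" "n \<le> N"
  shows "0 \<le> (\<Sum>i=1..n. w i * (\<Sum>k=1..i. Bcoef t \<alpha> i k * w k))"
proof (rule quadratic_form_nonneg)
  fix i j assume ij: "1 \<le> j" "j \<le> i" "i < n"
  show "Bcoef t \<alpha> (Suc i) j - (if j = 1 then 0 else Bcoef t \<alpha> (Suc i) (j - 1))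
      \<le> Bcoef t \<alpha> i j - (if j = 1 then 0 else Bcoef t \<alpha> i (j - 1))
        + (if j = i then Bcoef t \<alpha> i i else 0)"
    using Bcoef_diff_antimono[of \<alpha> j i] Bcoef_last_ge[of \<alpha> i] ij assms
    by (cases "j = i") auto
next
  fix j assume "1 \<le> j" "j \<le> n"
  then show "0 \<le> Bcoef t \<alpha> n j - (if j = 1 then 0 else Bcoef t \<alpha> n (j - 1))
        + (if j = n then Bcoef t \<alpha> n n else 0)"
    using Bcoef_last_nonneg[of \<alpha> n] Bcoef_diff_nonneg[of \<alpha> j n] assms
    by (cases "j = n") auto
qed

end

subsection \<open>Periodic grids\<close>

lemma sum_periodic_shift:
  fixes g :: "int \<Rightarrow> real"
  assumes "\<And>i. g (i + int M) = g i"
  shows "(\<Sum>i\<in>{1..int M}. g (i + 1)) = (\<Sum>i\<in>{1..int M}. g i)"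
proof (cases "M = 0")
  case False
  have "(\<Sum>i\<in>{1..int M}. g (i + 1)) = (\<Sum>i\<in>{2..int M + 1}. g i)"
    by (rule sum.reindex_bij_witness[of _ "\<lambda>i. i - 1" "\<lambda>i. i + 1"]) auto
  also have "{2..int M + 1} = insert (int M + 1) {2..int M}" using False by auto
  also have "(\<Sum>i\<in>insert (int M + 1) {2..int M}. g i) = g (1 + int M) + (\<Sum>i\<in>{2..int M}. g i)"
    by (subst sum.insert) (auto simp: add.commute)
  also have "\<dots> = (\<Sum>i\<in>insert 1 {2..int M}. g i)"
    unfolding assms by (subst sum.insert) auto
  also have "insert 1 {2..int M} = {1..int M}" using False by auto
  finally show ?thesis .
qed simp

text \<open>The second difference is a difference of first differences, and periodicity lets the
  backward one be shifted without boundary terms.\<close>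

lemma sum_by_parts_periodic:
  fixes u v :: "int \<Rightarrow> real"
  assumes "\<And>i. u (i + int M) = u i" "\<And>i. v (i + int M) = v i"
  shows "(\<Sum>i\<in>{1..int M}. (u (i + 1) + u (i - 1) - 2 * u i) * v i)
      = - (\<Sum>i\<in>{1..int M}. (u (i + 1) - u i) * (v (i + 1) - v i))"
proof -
  have "u (i + int M - 1) = u (i - 1)" for i using assms(1)[of "i - 1"] by (simp add: algebra_simps)
  then have "(\<Sum>i\<in>{1..int M}. (u (i + 1) - u (i + 1 - 1)) * v (i + 1))
      = (\<Sum>i\<in>{1..int M}. (u i - u (i - 1)) * v i)"
    by (intro sum_periodic_shift[where g = "\<lambda>i. (u i - u (i - 1)) * v i"]) (simp add: assms)
  then have "(\<Sum>i\<in>{1..int M}. (u (i + 1) - u i) * v (i + 1))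
      = (\<Sum>i\<in>{1..int M}. (u i - u (i - 1)) * v i)" by simp
  moreover have "(\<Sum>i\<in>{1..int M}. (u (i + 1) + u (i - 1) - 2 * u i) * v i)
      = (\<Sum>i\<in>{1..int M}. (u (i + 1) - u i) * v i) - (\<Sum>i\<in>{1..int M}. (u i - u (i - 1)) * v i)"
    unfolding sum_subtractf[symmetric] by (intro sum.cong) (auto simp: algebra_simps)
  moreover have "(\<Sum>i\<in>{1..int M}. (u (i + 1) - u i) * (v (i + 1) - v i))
      = (\<Sum>i\<in>{1..int M}. (u (i + 1) - u i) * v (i + 1)) - (\<Sum>i\<in>{1..int M}. (u (i + 1) - u i) * v i)"
    unfolding sum_subtractf[symmetric] by (intro sum.cong) (auto simp: algebra_simps)
  ultimately show ?thesis by simp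
qed

text \<open>The bilinear form obtained by polarizing \<open>ggradnorm2\<close>.\<close>

definition ggradinner :: "real \<Rightarrow> nat \<Rightarrow> grid \<Rightarrow> grid \<Rightarrow> real" where
  "ggradinner h M u v = h\<^sup>2 * (\<Sum>i\<in>{1..int M}. \<Sum>j\<in>{1..int M}.
      ((u (i + 1, j) - u (i, j)) / h) * ((v (i + 1, j) - v (i, j)) / h)
      + ((u (i, j + 1) - u (i, j)) / h) * ((v (i, j + 1) - v (i, j)) / h))"

lemma ggradnorm2_nonneg: "0 \<le> ggradnorm2 h M v"
  unfolding ggradnorm2_def by (intro mult_nonneg_nonneg sum_nonneg add_nonneg_nonneg) auto

lemma ginner_glap:
  assumes "periodic_grid M u" "periodic_grid M v"
  shows "ginner h M (glap h u) v = - ggradinner h M u v"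
proof -
  let ?I = "{1..int M}"
  have x: "(\<Sum>i\<in>?I. (u (i + 1, j) + u (i - 1, j) - 2 * u (i, j)) * v (i, j))
      = - (\<Sum>i\<in>?I. (u (i + 1, j) - u (i, j)) * (v (i + 1, j) - v (i, j)))" for j
    using assms by (intro sum_by_parts_periodic) (auto simp: periodic_grid_def)
  have y: "(\<Sum>j\<in>?I. (u (i, j + 1) + u (i, j - 1) - 2 * u (i, j)) * v (i, j))
      = - (\<Sum>j\<in>?I. (u (i, j + 1) - u (i, j)) * (v (i, j + 1) - v (i, j)))" for i
    using assms by (intro sum_by_parts_periodic) (auto simp: periodic_grid_def)
  have "(\<Sum>i\<in>?I. \<Sum>j\<in>?I. glap h u (i, j) * v (i, j))
      = ((\<Sum>j\<in>?I. \<Sum>i\<in>?I. (u (i + 1, j) + u (i - 1, j) - 2 * u (i, j)) * v (i, j))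
        + (\<Sum>i\<in>?I. \<Sum>j\<in>?I. (u (i, j + 1) + u (i, j - 1) - 2 * u (i, j)) * v (i, j))) / h\<^sup>2"
    unfolding sum.swap[of "\<lambda>j i. (u (i + 1, j) + u (i - 1, j) - 2 * u (i, j)) * v (i, j)"]
      sum.distrib[symmetric] sum_divide_distrib
    by (intro sum.cong) (auto simp: glap_def add_divide_distrib diff_divide_distrib algebra_simps)
  also have "\<dots> = - (((\<Sum>i\<in>?I. \<Sum>j\<in>?I. (u (i + 1, j) - u (i, j)) * (v (i + 1, j) - v (i, j)))
        + (\<Sum>i\<in>?I. \<Sum>j\<in>?I. (u (i, j + 1) - u (i, j)) * (v (i, j + 1) - v (i, j)))) / h\<^sup>2)"
    unfolding x y sum_negf
    by (subst sum.swap) (simp add: add_divide_distrib diff_divide_distrib)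
  also have "\<dots> = - (\<Sum>i\<in>?I. \<Sum>j\<in>?I.
      ((u (i + 1, j) - u (i, j)) / h) * ((v (i + 1, j) - v (i, j)) / h)
      + ((u (i, j + 1) - u (i, j)) / h) * ((v (i, j + 1) - v (i, j)) / h))"
    unfolding sum.distrib[symmetric] sum_divide_distrib
    by (intro arg_cong[where f = uminus] sum.cong) (auto simp: add_divide_distrib power2_eq_square)
  finally show ?thesis unfolding ginner_def ggradinner_def by simp
qed

text \<open>The offset average is the midpoint plus \<open>(1 - a) / 2\<close> times the increment.
  The midpoint part yields the difference of squares, the rest a multiple of the squared
  increment.\<close>

lemma ggradinner_offset_midpoint:
  "ggradinner h M (\<lambda>y. (1 - a / 2) * u y + a / 2 * v y) (\<lambda>y. u y - v y)
    = (ggradnorm2 h M u - ggradnorm2 h M v) / 2 + (1 - a) / 2 * ggradnorm2 h M (\<lambda>y. u y - v y)"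
proof -
  have ptw: "(((1 - a / 2) * x + a / 2 * y) - ((1 - a / 2) * x' + a / 2 * y')) / h * (((x - y) - (x' - y')) / h)
    = (((x - x') / h)\<^sup>2 - ((y - y') / h)\<^sup>2) / 2 + (1 - a) / 2 * (((x - y) - (x' - y')) / h)\<^sup>2"
    for x y x' y' :: real
  proof -
    have "((1 - a / 2) * X + a / 2 * Y) * (X - Y) = (X\<^sup>2 - Y\<^sup>2) / 2 + (1 - a) / 2 * (X - Y)\<^sup>2"
      for X Y :: real
      by (simp add: power2_eq_square field_simps)
    moreover have "(((1 - a / 2) * x + a / 2 * y) - ((1 - a / 2) * x' + a / 2 * y')) / h
        = (1 - a / 2) * ((x - x') / h) + a / 2 * ((y - y') / h)"
      "((x - y) - (x' - y')) / h = (x - x') / h - (y - y') / h"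
      by (simp_all add: add_divide_distrib diff_divide_distrib right_diff_distrib)
    ultimately show ?thesis by (simp only:)
  qed
  show ?thesis
    unfolding ggradinner_def ggradnorm2_def ptw
    by (simp add: sum.distrib sum_subtractf sum_distrib_left sum_divide_distrib[symmetric] algebra_simps
       add_divide_distrib diff_divide_distrib)
qed

lemma ginner_lincomb_left:
  "ginner h M (\<lambda>y. a * u y + b * v y) w = a * ginner h M u w + b * ginner h M v w"
  by (simp add: ginner_def sum.distrib sum_distrib_left algebra_simps)

lemma ginner_scale_right: "ginner h M u (\<lambda>y. w y / c) = ginner h M u w / c"
  by (simp add: ginner_def sum_divide_distrib[symmetric])

subsection \<open>Energy stability\<close>

text \<open>Moving the time sum innermost leaves, at every grid point, the scalar form of
  \<open>Bcoef_form_nonneg\<close> in the increments of \<open>\<phi>\<close>.\<close>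

lemma sum_ginner_Dalpha_nonneg:
  assumes "mesh t N" "0 < \<alpha>" "\<alpha> < 1" "n \<le> N"
  shows "0 \<le> (\<Sum>k=1..n. ginner h M (Dalpha t \<alpha> \<phi> k) (\<lambda>y. \<phi> k y - \<phi> (k - 1) y))"
proof -
  let ?I = "{1..int M}"
  have "(\<Sum>k=1..n. ginner h M (Dalpha t \<alpha> \<phi> k) (\<lambda>y. \<phi> k y - \<phi> (k - 1) y))
      = h\<^sup>2 * (\<Sum>i\<in>?I. \<Sum>j\<in>?I. \<Sum>k=1..n.
          Dalpha t \<alpha> \<phi> k (i, j) * (\<phi> k (i, j) - \<phi> (k - 1) (i, j)))"
    unfolding ginner_def sum_distrib_left[symmetric]
    by (subst sum.swap, subst (2) sum.swap) simp
  also have "\<dots> \<ge> 0"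
  proof (intro mult_nonneg_nonneg sum_nonneg[of ?I])
    fix i j
    show "0 \<le> (\<Sum>k=1..n. Dalpha t \<alpha> \<phi> k (i, j) * (\<phi> k (i, j) - \<phi> (k - 1) (i, j)))"
      using mesh.Bcoef_form_nonneg[OF assms, of "\<lambda>k. \<phi> k (i, j) - \<phi> (k - 1) (i, j)"]
      by (simp add: Dalpha_def mult.commute)
  qed auto
  finally show ?thesis .
qed

text \<open>Testing the equation for \<open>D\<close> with the increment produces the same
  \<open>c\<close> and \<open>r\<close> terms as \<open>aux\<close>, with opposite sign in the
  balance. What survives is the gradient part of the energy and a dissipation that is nonnegative
  for \<open>a \<le> 1\<close>.\<close>

lemma energy_increment_le:
  fixes c r :: grid
  assumes per: "periodic_grid M u" "periodic_grid M v" and "0 < m" "a \<le> 1" "0 < \<tau>"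
    and eq: "\<And>x. D x = m * (\<epsilon>\<^sup>2 * glap h (\<lambda>y. (1 - a / 2) * u y + a / 2 * v y) x + W * c x - \<kappa> * r x)"
    and aux: "(R1 - R0) / \<tau> = - W * ginner h M c (\<lambda>y. (u y - v y) / \<tau>)
        + \<kappa> * ginner h M r (\<lambda>y. (u y - v y) / \<tau>)"
  shows "energy_h \<epsilon> h M u R1 - energy_h \<epsilon> h M v R0
      \<le> - ginner h M D (\<lambda>y. u y - v y) / m"
proof -
  let ?d = "\<lambda>y. u y - v y" and ?s = "\<lambda>y. (1 - a / 2) * u y + a / 2 * v y"
  have aux': "R1 - R0 = - W * ginner h M c ?d + \<kappa> * ginner h M r ?d"
    using aux \<open>0 < \<tau>\<close> unfolding ginner_scale_right by (simp add: field_simps)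
  have "D = (\<lambda>x. m * \<epsilon>\<^sup>2 * glap h ?s x + m * ((W * c x) + (- \<kappa>) * r x))"
    by (rule ext) (simp add: eq algebra_simps)
  then have "ginner h M D ?d = m * \<epsilon>\<^sup>2 * ginner h M (glap h ?s) ?d
      + m * (W * ginner h M c ?d + (- \<kappa>) * ginner h M r ?d)"
    by (simp only: ginner_lincomb_left)
  then have D: "ginner h M D ?d / m = \<epsilon>\<^sup>2 * ginner h M (glap h ?s) ?d
      + (W * ginner h M c ?d - \<kappa> * ginner h M r ?d)"
    using \<open>0 < m\<close> by (simp add: add_divide_distrib)
  have lap: "ginner h M (glap h ?s) ?d = - ((ggradnorm2 h M u - ggradnorm2 h M v) / 2
      + (1 - a) / 2 * ggradnorm2 h M ?d)"
    unfolding ggradinner_offset_midpoint[symmetric]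
    using per by (intro ginner_glap) (auto simp: periodic_grid_def)
  have "\<epsilon>\<^sup>2 / 2 * A + R1 - (\<epsilon>\<^sup>2 / 2 * B + R0) = - X - \<epsilon>\<^sup>2 * C"
    if "R1 - R0 = - W * P + \<kappa> * Q" "X = \<epsilon>\<^sup>2 * - ((A - B) / 2 + C) + (W * P - \<kappa> * Q)"
    for A B C P Q X :: real
    using that by (simp add: field_simps)
  from this[OF aux' D[unfolded lap]] have "energy_h \<epsilon> h M u R1 - energy_h \<epsilon> h M v R0
      = - (ginner h M D ?d / m) - \<epsilon>\<^sup>2 * ((1 - a) / 2 * ggradnorm2 h M ?d)"
    unfolding energy_h_def .
  moreover have "0 \<le> \<epsilon>\<^sup>2 * ((1 - a) / 2 * ggradnorm2 h M ?d)"
    using \<open>a \<le> 1\<close> ggradnorm2_nonneg by (intro mult_nonneg_nonneg) auto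
  ultimately show ?thesis by simp
qed

theorem mainTheorem11:
  fixes L \<epsilon> m \<alpha> \<kappa> \<beta> \<theta> \<theta>c K1 T h :: real
    and M N :: nat
    and F f V V' :: "real \<Rightarrow> real"
    and t :: "nat \<Rightarrow> real"
    and \<phi> :: "nat \<Rightarrow> grid" and R :: "nat \<Rightarrow> real" and hat1 :: grid
  assumes L_pos: "L > 0" and M_pos: "M > 0" and h_def: "h = L / real M"
    and m_pos: "m > 0" and eps_pos: "\<epsilon> > 0"
    and alpha: "0 < \<alpha>" "\<alpha> < 1"
    and kappa_nonneg: "\<kappa> \<ge> 0"
    and nonlin: "(F = F_dw \<and> f = f_dw \<and> \<beta> = 1) \<or>
                 (0 < \<theta> \<and> \<theta> < \<theta>c \<and> F = F_fh \<theta> \<theta>c \<and> f = f_fh \<theta> \<theta>c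
                    \<and> 0 < \<beta> \<and> \<beta> < 1 \<and> f \<beta> = 0)"
    \<comment> \<open>(A1)\<close>
    and V_deriv: "\<And>z. (V has_real_derivative V' z) (at z)"
    and V'_cont: "continuous_on UNIV V'"
    and V'_lip: "\<exists>C. \<forall>z1 z2. \<bar>V' z1 - V' z2\<bar> \<le> C * \<bar>z1 - z2\<bar>"
    and V_1: "V 1 = 1" and V'_1: "V' 1 = 0"
    and V'_bound: "\<And>z. \<bar>V' z\<bar> \<le> K1"
    \<comment> \<open>(A2) with K_2 = 1\<close>
    and V_range: "\<And>z. 0 \<le> V z \<and> V z \<le> 1"
    \<comment> \<open>(A3)\<close>
    and V_mono: "\<And>z1 z2. \<bar>z1 - 1\<bar> \<le> \<bar>z2 - 1\<bar> \<Longrightarrow> \<bar>V z1 - 1\<bar> \<le> \<bar>V z2 - 1\<bar>"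
    \<comment> \<open>time grid\<close>
    and t0: "t 0 = 0" and tN: "t N = T"
    and t_mono: "\<And>k. 1 \<le> k \<Longrightarrow> k \<le> N \<Longrightarrow> t (k - 1) < t k"
    and ratio_bound: "\<And>k. 2 \<le> k \<Longrightarrow> k \<le> N \<Longrightarrow> ratio t k \<ge> 4 / 7"
    and kappa_bound: "\<kappa> \<ge> (SUP z\<in>{- \<beta>..\<beta>}. \<bar>deriv f z\<bar>)"
    and tau1_bound: "tau t 1 \<le> min
        ((4 / (11 * (\<alpha> / 2) * m * (\<kappa> + 4 * \<epsilon>\<^sup>2 / h\<^sup>2) * Gamma (2 - \<alpha>))) powr (1 / \<alpha>))
        ((4 / (11 * \<kappa> * (1 - \<alpha> / 2) * m * Gamma (2 - \<alpha>))) powr (1 / \<alpha>))"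
    \<comment> \<open>initial data\<close>
    and phi_per: "\<And>n. n \<le> N \<Longrightarrow> periodic_grid M (\<phi> n)"
    and phi0_bound: "gsupnorm M (\<phi> 0) \<le> \<beta>"
    \<comment> \<open>first step predictor\<close>
    and hat1_per: "periodic_grid M hat1"
    and hat1_bound: "gsupnorm M hat1 \<le> \<beta>"
    and hat1_eq: "\<And>x. Bcoef t \<alpha> 1 1 * (hat1 x - \<phi> 0 x) =
        m * (\<epsilon>\<^sup>2 * glap h (\<lambda>y. (1 - \<alpha> / 2) * hat1 y + \<alpha> / 2 * \<phi> 0 y) x
             + f ((1 - \<alpha> / 2) * hat1 x + \<alpha> / 2 * \<phi> 0 x))"
    \<comment> \<open>the sESAV step\<close>
    and scheme_phi: "\<And>n x. 1 \<le> n \<Longrightarrow> n \<le> N \<Longrightarrow>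
        (let hs = (\<lambda>y. (1 - \<alpha> / 2) * phat t \<beta> \<phi> hat1 n y + \<alpha> / 2 * \<phi> (n - 1) y);
             ps = (\<lambda>y. (1 - \<alpha> / 2) * \<phi> n y + \<alpha> / 2 * \<phi> (n - 1) y);
             Vn = V (gh F h M hs (R (n - 1)))
         in Dalpha t \<alpha> \<phi> n x =
              m * (\<epsilon>\<^sup>2 * glap h ps x + Vn * f (hs x) - \<kappa> * (ps x - Vn * hs x)))"
    and scheme_R: "\<And>n. 1 \<le> n \<Longrightarrow> n \<le> N \<Longrightarrow>
        (let hs = (\<lambda>y. (1 - \<alpha> / 2) * phat t \<beta> \<phi> hat1 n y + \<alpha> / 2 * \<phi> (n - 1) y);
             ps = (\<lambda>y. (1 - \<alpha> / 2) * \<phi> n y + \<alpha> / 2 * \<phi> (n - 1) y);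
             Vn = V (gh F h M hs (R (n - 1)));
             D\<phi> = (\<lambda>y. (\<phi> n y - \<phi> (n - 1) y) / tau t n)
         in (R n - R (n - 1)) / tau t n =
              - Vn * ginner h M (\<lambda>y. f (hs y)) D\<phi>
              + \<kappa> * ginner h M (\<lambda>y. ps y - Vn * hs y) D\<phi>)"
  shows "\<forall>n. 1 \<le> n \<and> n \<le> N \<longrightarrow>
           energy_h \<epsilon> h M (\<phi> n) (R n) \<le> energy_h \<epsilon> h M (\<phi> 0) (R 0)"
proof -
  have mesh: "mesh t N"
    using t_mono ratio_bound by unfold_locales
  have step: "energy_h \<epsilon> h M (\<phi> n) (R n) - energy_h \<epsilon> h M (\<phi> (n - 1)) (R (n - 1))
      \<le> - ginner h M (Dalpha t \<alpha> \<phi> n) (\<lambda>y. \<phi> n y - \<phi> (n - 1) y) / m"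
    if n: "1 \<le> n" "n \<le> N" for n
  proof (rule energy_increment_le)
    show "periodic_grid M (\<phi> n)" "periodic_grid M (\<phi> (n - 1))" using phi_per n by auto
    show "0 < m" "\<alpha> \<le> 1" "0 < tau t n" using m_pos alpha mesh.tau_pos[OF mesh] n by auto
  next
    define hs where "hs = (\<lambda>y. (1 - \<alpha> / 2) * phat t \<beta> \<phi> hat1 n y + \<alpha> / 2 * \<phi> (n - 1) y)"
    fix x
    show "Dalpha t \<alpha> \<phi> n x = m * (\<epsilon>\<^sup>2 * glap h (\<lambda>y. (1 - \<alpha> / 2) * \<phi> n y + \<alpha> / 2 * \<phi> (n - 1) y) x
        + V (gh F h M hs (R (n - 1))) * f (hs x)
        - \<kappa> * ((1 - \<alpha> / 2) * \<phi> n x + \<alpha> / 2 * \<phi> (n - 1) x - V (gh F h M hs (R (n - 1))) * hs x))"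
      using scheme_phi[OF n] unfolding hs_def Let_def .
    show "(R n - R (n - 1)) / tau t n
        = - V (gh F h M hs (R (n - 1))) * ginner h M (\<lambda>y. f (hs y)) (\<lambda>y. (\<phi> n y - \<phi> (n - 1) y) / tau t n)
        + \<kappa> * ginner h M (\<lambda>x. (1 - \<alpha> / 2) * \<phi> n x + \<alpha> / 2 * \<phi> (n - 1) x
            - V (gh F h M hs (R (n - 1))) * hs x) (\<lambda>y. (\<phi> n y - \<phi> (n - 1) y) / tau t n)"
      using scheme_R[OF n] unfolding hs_def Let_def .
  qed
  \<comment> \<open>Single increments need not be negative, because the fractional derivative
    carries memory; only the sum over all levels from the start has a sign.\<close>
  have "energy_h \<epsilon> h M (\<phi> n) (R n) - energy_h \<epsilon> h M (\<phi> 0) (R 0)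
      \<le> - (\<Sum>k=1..n. ginner h M (Dalpha t \<alpha> \<phi> k) (\<lambda>y. \<phi> k y - \<phi> (k - 1) y)) / m"
    if "n \<le> N" for n
    using that
  proof (induction n)
    case (Suc n)
    then show ?case using step[of "Suc n"] by (simp add: add_divide_distrib diff_divide_distrib)
  qed simp
  moreover have "0 \<le> (\<Sum>k=1..n. ginner h M (Dalpha t \<alpha> \<phi> k) (\<lambda>y. \<phi> k y - \<phi> (k - 1) y)) / m"
    if "n \<le> N" for n
    using sum_ginner_Dalpha_nonneg[OF mesh alpha that] m_pos by simp
  ultimately show ?thesis by fastforce
qed

end
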